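(* Suppose the following hypotheses on the coefficients $F_1,F,h:\mathbb{R}^d\to\mathbb{R}^d$ and $G_1,G:\mathbb{R}^d\to\mathbb{R}^{d\times m}$ hold. (i) There are $L_1>0$ and $\gamma\ge 0$ such that for all $x,y\in\mathbb{R}^d$: $|F_1(x)-F_1(y)|\vee|G_1(x)-G_1(y)|\vee|h(x)-h(y)|\le L_1|x-y|$ and $|F(x)-F(y)|\vee|G(x)-G(y)|\le L_1(1+|x|^{\gamma}+|y|^{\gamma})|x-y|$. Let $K_1>0$ be a constant with $|F_1(x)|\vee|G_1(x)|\vee|h(x)|\le K_1(1+|x|)$ for all $x\in\mathbb R^d$. (ii) There are $\bar r>2$ and $L_2>0$ such that $(x-y)^T(F(x)-F(y))+\frac{\bar r-1}{2}|G(x)-G(y)|^2\le L_2|x-y|^2$ for all $x,y\in\mathbb{R}^d$. (iii) There are $\bar p>\bar r$ and $K_2>0$ such that $x^TF(x)+\frac{\bar p-1}{2}|G(x)|^2\le K_2(1+|x|^2)$ for all $x\in\mathbb{R}^d$. (iv) There are constants $\bar\alpha_1,\bar\alpha_2,\bar\beta_2>0$, $\bar\beta_1>\bar\beta_2+\max\big(\lambda(4K_1^2+1),\,2\lambda K_1(2+K_1)\big)$ and $\theta\in(0,\infty)$ such that for all $x\in\mathbb R^d$ $$2x^TF_1(x)+(1+\theta)|G_1(x)|^2\le\bar\alpha_1-\bar\beta_1|x|^2,\qquad 2x^TF(x)+(1+\theta^{-1})|G(x)|^2\le\bar\alpha_2+\bar\beta_2|x|^2.$$ Then for any $\epsilon\in\big(0,\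 \bar\beta_1-\bar\beta_2-\max(\lambda(4K_1^2+1),2\lambda K_1(2+K_1))\big)$ there is $\hat\Delta\in(0,1)$ such that for all $\Delta\in(0,\hat\Delta)$ and any initial value $x_0\in\mathbb R^d$, the solution of the partially truncated EM method satisfies $$\limsup_{k\to\infty}\mathbb E|X_\Delta(t_k)|^2\le\frac{\bar\alpha_1+\bar\alpha_2+2\lambda K_1(2+K_1)+\epsilon}{\bar\beta_1-\bar\beta_2-2\lambda K_1(2+K_1)-\epsilon}.$$
   Context: Notation: $a\vee b=\max(a,b)$, $a\wedge b=\min(a,b)$; $|\cdot|$ is the Euclidean norm of a vector and the trace norm $|A|=\sqrt{\mathrm{trace}(A^TA)}$ of a matrix. $(\Omega,\mathcal F,\mathbb P)$ is a complete probability space with a filtration $\{\mathcal F_t\}_{t\ge0}$ satisfying the usual conditions; $B$ is an $m$-dimensional Brownian motion and $N$ a scalar Poisson process with jump intensity $\lambda>0$, both with respect to this filtration. Convention in (iv): if there is no super-linear term $G$, set $\theta=0$ and $\theta^{-1}|G(x)|^2=0$; if the linear term $G_1$ is absent, set $\theta=\infty$ and $\theta|G_1(x)|^2=0$. Underlying SDE: $dx(t)=f(x(t^-))\,dt+g(x(t^-))\,dB(t)+h(x(t^-))\,dN(t)$, $x(0)=x_0$, with $f=F_1+F$, $g=G_1+G$. Partially truncated Euler–Maruyama (EM) method: $\mu:\mathbb R^+\to\mathbb R^+$ is strictly increasing with $\mu(n)\to\infty$ as $n\to\infty$ and $\sup_{|x|\le n}(|F(x)|\vee|G(x)|)\le\mu(n)$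 for all $n\ge1$; $\mu^{-1}$ is its inverse. $\varphi:(0,1]\to(0,\infty)$ is strictly decreasing with $\lim_{\Delta\to0}\varphi(\Delta)=\infty$ and $(\varphi(\Delta))^{\bar p}\le\Delta^{-1}\wedge\Delta^{-\bar p/4}$ for $\Delta\in(0,1]$ (it is understood that $\mu^{-1}(\varphi(\Delta))$ is defined). For a step size $\Delta$, $\pi_\Delta(x)=(|x|\wedge\mu^{-1}(\varphi(\Delta)))\frac{x}{|x|}$ (with $x/|x|=0$ for $x=0$), $F_\Delta(x)=F(\pi_\Delta(x))$, $G_\Delta(x)=G(\pi_\Delta(x))$, $f_\Delta=F_1+F_\Delta$, $g_\Delta=G_1+G_\Delta$. With $t_k=k\Delta$, the scheme is $X_\Delta(0)=x_0$, $X_\Delta(t_{k+1})=X_\Delta(t_k)+f_\Delta(X_\Delta(t_k))\Delta+g_\Delta(X_\Delta(t_k))(B(t_{k+1})-B(t_k))+h(X_\Delta(t_k))(N(t_{k+1})-N(t_k))$, $k\ge0$. *)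

theory Defs
  imports "HOL-Probability.Probability"
begin

(* The norm of a matrix in real^'m^'d is the trace norm sqrt (trace (A^T A)). *)
lemma norm_matrix_eq_trace:
  fixes A :: "real ^ 'm ^ 'd"
  shows "norm A = sqrt (trace (transpose A ** A))"
proof -
  have "trace (transpose A ** A) = (\<Sum>j\<in>UNIV. \<Sum>i\<in>UNIV. (A $ i $ j)\<^sup>2)"
    by (simp add: trace_def matrix_matrix_mult_def transpose_def power2_eq_square)
  also have "\<dots> = (\<Sum>i\<in>UNIV. \<Sum>j\<in>UNIV. (A $ i $ j)\<^sup>2)"
    by (rule sum.swap)
  also have "\<dots> = (\<Sum>i\<in>UNIV. (norm (A $ i))\<^sup>2)"
    by (simp add: norm_vec_def L2_set_def sum_nonneg)
  finally show ?thesis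
    by (simp add: norm_vec_def L2_set_def)
qed

(* powr with the convention 0^0 = 1, whereas 0 powr 0 = 0 in the library. *)
definition rpow :: "real \<Rightarrow> real \<Rightarrow> real" where
  "rpow r \<gamma> = (if \<gamma> = 0 then 1 else r powr \<gamma>)"

subsection \<open>Filtration, Brownian motion, Poisson process\<close>

(* Time runs through [0, \<infinity>); F t for negative t is irrelevant. *)
definition usual_filtration :: "'a measure \<Rightarrow> (real \<Rightarrow> 'a measure) \<Rightarrow> bool" where
  "usual_filtration M \<F> \<longleftrightarrow>
     (\<forall>t\<ge>0. subalgebra M (\<F> t)) \<and>
     (\<forall>s\<ge>0. \<forall>t\<ge>s. sets (\<F> s) \<subseteq> sets (\<F> t)) \<and>
     (\<forall>t\<ge>0. sets (\<F> t) = (\<Inter>s\<in>{t<..}. sets (\<F> s))) \<and>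
     null_sets M \<subseteq> sets (\<F> 0)"

definition indep_of_past ::
  "'a measure \<Rightarrow> 'a measure \<Rightarrow> ('a \<Rightarrow> 'b::topological_space) \<Rightarrow> bool" where
  "indep_of_past M \<G> Y \<longleftrightarrow>
     prob_space.indep_set M (sets \<G>) {Y -` A \<inter> space M | A. A \<in> sets borel}"

(* The increment over [s,t] has law N(0, (t - s) I). *)
definition brownian_motion ::
  "'a measure \<Rightarrow> (real \<Rightarrow> 'a measure) \<Rightarrow> (real \<Rightarrow> 'a \<Rightarrow> real ^ 'm) \<Rightarrow> bool" where
  "brownian_motion M \<F> B \<longleftrightarrow>
     (\<forall>t\<ge>0. B t \<in> borel_measurable (\<F> t)) \<and>
     (AE \<omega> in M. B 0 \<omega> = 0) \<and>
     (AE \<omega> in M. continuous_on {0..} (\<lambda>t. B t \<omega>)) \<and>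
     (\<forall>s\<ge>0. \<forall>t>s.
        indep_of_past M (\<F> s) (\<lambda>\<omega>. B t \<omega> - B s \<omega>) \<and>
        distributed M lborel (\<lambda>\<omega>. B t \<omega> - B s \<omega>)
          (\<lambda>x. ennreal (\<Prod>i\<in>UNIV. normal_density 0 (sqrt (t - s)) (x $ i))))"

(* Real-valued, since the increments are subtracted; the increments are
   almost surely natural numbers by their law. *)
definition poisson_process ::
  "'a measure \<Rightarrow> (real \<Rightarrow> 'a measure) \<Rightarrow> real \<Rightarrow> (real \<Rightarrow> 'a \<Rightarrow> real) \<Rightarrow> bool" where
  "poisson_process M \<F> lam N \<longleftrightarrow>
     (\<forall>t\<ge>0. N t \<in> borel_measurable (\<F> t)) \<and>
     (AE \<omega> in M. N 0 \<omega> = 0) \<and>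
     (AE \<omega> in M. (\<forall>t\<ge>0. continuous (at_right t) (\<lambda>s. N s \<omega>)) \<and>
                  (\<forall>t>0. \<exists>l. ((\<lambda>s. N s \<omega>) \<longlongrightarrow> l) (at_left t))) \<and>
     (\<forall>s\<ge>0. \<forall>t>s.
        indep_of_past M (\<F> s) (\<lambda>\<omega>. N t \<omega> - N s \<omega>) \<and>
        distr M borel (\<lambda>\<omega>. N t \<omega> - N s \<omega>)
          = distr (measure_pmf (poisson_pmf (lam * (t - s)))) borel real)"

subsection \<open>The dissipativity condition\<close>

(* theta = 0 is the convention for an absent G (the term |G|^2 / theta is read as 0),
   theta = \<infinity> the convention for an absent G1 (the term theta |G1|^2 is read as 0). *)
definition split_dissipative ::
  "(real ^ 'd \<Rightarrow> real ^ 'd) \<Rightarrow> (real ^ 'd \<Rightarrow> real ^ 'd) \<Rightarrow>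
   (real ^ 'd \<Rightarrow> real ^ 'm ^ 'd) \<Rightarrow> (real ^ 'd \<Rightarrow> real ^ 'm ^ 'd) \<Rightarrow>
   ereal \<Rightarrow> real \<Rightarrow> real \<Rightarrow> real \<Rightarrow> real \<Rightarrow> bool" where
  "split_dissipative F1 F G1 G \<theta> \<alpha>1 \<alpha>2 \<beta>1 \<beta>2 \<longleftrightarrow>
     (\<exists>t>0. \<theta> = ereal t \<and>
        (\<forall>x. 2 * (x \<bullet> F1 x) + (1 + t) * (norm (G1 x))\<^sup>2 \<le> \<alpha>1 - \<beta>1 * (norm x)\<^sup>2) \<and>
        (\<forall>x. 2 * (x \<bullet> F x) + (1 + inverse t) * (norm (G x))\<^sup>2 \<le> \<alpha>2 + \<beta>2 * (norm x)\<^sup>2)) \<or>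
     (\<theta> = 0 \<and> (\<forall>x. G x = 0) \<and>
        (\<forall>x. 2 * (x \<bullet> F1 x) + (norm (G1 x))\<^sup>2 \<le> \<alpha>1 - \<beta>1 * (norm x)\<^sup>2) \<and>
        (\<forall>x. 2 * (x \<bullet> F x) \<le> \<alpha>2 + \<beta>2 * (norm x)\<^sup>2)) \<or>
     (\<theta> = \<infinity> \<and> (\<forall>x. G1 x = 0) \<and>
        (\<forall>x. 2 * (x \<bullet> F1 x) \<le> \<alpha>1 - \<beta>1 * (norm x)\<^sup>2) \<and>
        (\<forall>x. 2 * (x \<bullet> F x) + (norm (G x))\<^sup>2 \<le> \<alpha>2 + \<beta>2 * (norm x)\<^sup>2))"

subsection \<open>The partially truncated Euler-Maruyama scheme\<close>

(* The bound on the supremum is stated pointwise, for real radii u \<ge> 1. *)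
definition growth_control ::
  "(real ^ 'd \<Rightarrow> real ^ 'd) \<Rightarrow> (real ^ 'd \<Rightarrow> real ^ 'm ^ 'd) \<Rightarrow> (real \<Rightarrow> real) \<Rightarrow> bool" where
  "growth_control F G \<mu> \<longleftrightarrow>
     \<mu> ` {0..} \<subseteq> {0..} \<and> strict_mono_on {0..} \<mu> \<and> filterlim \<mu> at_top at_top \<and>
     (\<forall>u\<ge>1. \<forall>x. norm x \<le> u \<longrightarrow> max (norm (F x)) (norm (G x)) \<le> \<mu> u)"

(* The last conjunct says that the inverse of \<mu> is defined at every \<phi> \<Delta>. *)
definition truncation_rate :: "real \<Rightarrow> (real \<Rightarrow> real) \<Rightarrow> (real \<Rightarrow> real) \<Rightarrow> bool" where
  "truncation_rate p \<mu> \<phi> \<longleftrightarrow>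
     (\<forall>\<Delta>\<in>{0<..1}. 0 < \<phi> \<Delta>) \<and> strict_antimono_on {0<..1} \<phi> \<and>
     filterlim \<phi> at_top (at_right 0) \<and>
     (\<forall>\<Delta>\<in>{0<..1}. \<phi> \<Delta> powr p \<le> min (\<Delta> powr (- 1)) (\<Delta> powr (- p / 4))) \<and>
     (\<forall>\<Delta>\<in>{0<..1}. \<phi> \<Delta> \<in> \<mu> ` {0..})"

definition trunc_radius :: "(real \<Rightarrow> real) \<Rightarrow> (real \<Rightarrow> real) \<Rightarrow> real \<Rightarrow> real" where
  "trunc_radius \<mu> \<phi> \<Delta> = inv_into {0..} \<mu> (\<phi> \<Delta>)"

(* sgn x = x / norm x, with sgn 0 = 0. *)
definition trunc_map :: "(real \<Rightarrow> real) \<Rightarrow> (real \<Rightarrow> real) \<Rightarrow> real \<Rightarrow> real ^ 'd \<Rightarrow> real ^ 'd" where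
  "trunc_map \<mu> \<phi> \<Delta> x = min (norm x) (trunc_radius \<mu> \<phi> \<Delta>) *\<^sub>R sgn x"

(* Only the super-linear part A is truncated. *)
definition part_trunc ::
  "(real \<Rightarrow> real) \<Rightarrow> (real \<Rightarrow> real) \<Rightarrow> real \<Rightarrow>
   (real ^ 'd \<Rightarrow> 'b::plus) \<Rightarrow> (real ^ 'd \<Rightarrow> 'b) \<Rightarrow> real ^ 'd \<Rightarrow> 'b" where
  "part_trunc \<mu> \<phi> \<Delta> A1 A x = A1 x + A (trunc_map \<mu> \<phi> \<Delta> x)"

primrec pt_EM ::
  "(real ^ 'd \<Rightarrow> real ^ 'd) \<Rightarrow> (real ^ 'd \<Rightarrow> real ^ 'd) \<Rightarrow>
   (real ^ 'd \<Rightarrow> real ^ 'm ^ 'd) \<Rightarrow> (real ^ 'd \<Rightarrow> real ^ 'm ^ 'd) \<Rightarrow>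
   (real ^ 'd \<Rightarrow> real ^ 'd) \<Rightarrow> (real \<Rightarrow> real) \<Rightarrow> (real \<Rightarrow> real) \<Rightarrow>
   (real \<Rightarrow> 'a \<Rightarrow> real ^ 'm) \<Rightarrow> (real \<Rightarrow> 'a \<Rightarrow> real) \<Rightarrow>
   real \<Rightarrow> real ^ 'd \<Rightarrow> nat \<Rightarrow> 'a \<Rightarrow> real ^ 'd" where
  "pt_EM F1 F G1 G h \<mu> \<phi> B N \<Delta> x0 0 = (\<lambda>\<omega>. x0)"
| "pt_EM F1 F G1 G h \<mu> \<phi> B N \<Delta> x0 (Suc k) = (\<lambda>\<omega>.
     let X = pt_EM F1 F G1 G h \<mu> \<phi> B N \<Delta> x0 k \<omega>;
         s = real k * \<Delta>; t = real (Suc k) * \<Delta>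
     in X + \<Delta> *\<^sub>R part_trunc \<mu> \<phi> \<Delta> F1 F X
          + part_trunc \<mu> \<phi> \<Delta> G1 G X *v (B t \<omega> - B s \<omega>)
          + (N t \<omega> - N s \<omega>) *\<^sub>R h X)"

end

theory Submission
  imports Defs
begin

text \<open>Conditioning on the past, one step of the scheme turns \<open>\<bar>x\<bar>\<^sup>2\<close> into its value for the drift part plus
  \<open>\<Delta> \<bar>g\<^sub>\<Delta>\<bar>\<^sup>2\<close>, the jump terms, and a Brownian--Poisson cross term, which vanishes because both processes
  are driven by the same filtration. Condition (iv) survives truncation up to \<open>\<alpha>\<^sub>2 / R\<^sup>2\<close>, where the
  truncation radius \<open>R\<close> tends to infinity as \<open>\<Delta>\<close> tends to \<open>0\<close>, and \<open>\<phi>(\<Delta>)\<^sup>2 \<Delta> \<le> sqrt \<Delta>\<close> makes the second-order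
  terms negligible. Hence \<open>E \<bar>X\<^bsub>k+1\<^esub>\<bar>\<^sup>2 \<le> (1 - b \<Delta>) E \<bar>X\<^bsub>k\<^esub>\<bar>\<^sup>2 + a \<Delta>\<close> with \<open>a / b\<close> the claimed bound.\<close>

text \<open>No conditional expectations are formed. Every conditioning argument is reduced to scalar
  products \<xi> * f(increment), with \<xi> measurable for the filtration at the start of the step;
  vectors and matrices are therefore expanded into coordinates. The mean drift of one step is f +
  \<lambda> h, with f the truncated drift, and the second-order terms are exactly the square
  \<Delta>^2 |f + \<lambda> h|^2. The constant 2 \<lambda> K1 (2 + K1) bounds the first-order jump
  contribution \<lambda> |h|^2 + 2 \<lambda> x.h relative to 1 + |x|^2. In the coefficient of |x|^2,
  one half of \<epsilon> pays for truncation and the other half for the second-order terms. Since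
  the claim is about a nonnegative integral, square integrability of every iterate has to be
  established along with the recursion.\<close>

lemma borel_measurable_vec_nth:
  fixes f :: "'c \<Rightarrow> 'b::real_normed_vector ^ 'n"
  assumes "f \<in> borel_measurable M"
  shows "(\<lambda>x. f x $ i) \<in> borel_measurable M"
  by (rule measurable_compose[OF assms]) (intro borel_measurable_continuous_onI continuous_intros)

section \<open>Gaussian vectors: marginals, independence of coordinates, moments\<close>

lemma nn_integral_lborel_vec_prod:
  fixes f :: "'m::finite \<Rightarrow> real \<Rightarrow> real"
  assumes [measurable]: "\<And>i. f i \<in> borel_measurable borel" and nn: "\<And>i x. 0 \<le> f i x"
  shows "(\<integral>\<^sup>+x. ennreal (\<Prod>i\<in>UNIV. f i (x $ i)) \<partial>(lborel :: (real^'m) measure))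
           = (\<Prod>i\<in>UNIV. \<integral>\<^sup>+x. ennreal (f i x) \<partial>lborel)"
proof -
  have B: "(Basis :: (real^'m) set) = (\<lambda>i. axis i 1) ` UNIV"
    by (auto simp: Basis_vec_def)
  have inj: "inj (\<lambda>i::'m. axis i (1::real))"
    by (auto simp: inj_on_def axis_eq_axis)
  \<comment> \<open>The library product formula is indexed by basis vectors, so the family is
    transported along the injection sending \<open>i\<close> to \<open>axis i 1\<close>.\<close>
  define g where "g b = f (the_inv (\<lambda>i. axis i (1::real)) b)" for b :: "real^'m"
  have g: "g (axis i 1) = f i" for i
    unfolding g_def using the_inv_f_f[OF inj] by simp
  have [measurable]: "g b \<in> borel_measurable borel" for b unfolding g_def by simp
  have "(\<integral>\<^sup>+x. (\<Prod>b\<in>Basis. ennreal (g b (x \<bullet> b))) \<partial>(lborel :: (real^'m) measure))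
          = (\<Prod>b\<in>(Basis :: (real^'m) set). \<integral>\<^sup>+x. ennreal (g b x) \<partial>lborel)"
    by (rule nn_integral_lborel_prod) auto
  then show ?thesis
    by (simp add: B prod.reindex[OF inj] g inner_axis prod_ennreal nn)
qed

text \<open>Independence of random variables is a statement about generated sigma-algebras. The
  preimages of measurable sets are stable under intersection, so the product rule extends from
  them.\<close>

lemma (in prob_space) indep_varI_prob:
  assumes [measurable]: "random_variable S X" "random_variable T Y"
    and eq: "\<And>A C. A \<in> sets S \<Longrightarrow> C \<in> sets T \<Longrightarrow>
      prob {\<omega> \<in> space M. X \<omega> \<in> A \<and> Y \<omega> \<in> C} = prob {\<omega> \<in> space M. X \<omega> \<in> A} * prob {\<omega> \<in> space M. Y \<omega> \<in> C}"
  shows "indep_var S X T Y"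
proof -
  have st: "Int_stable {Z -` A \<inter> space M |A. A \<in> sets U}" for Z :: "'a \<Rightarrow> 'z" and U
    unfolding Int_stable_def by (auto, metis sets.Int vimage_Int Int_assoc Int_left_commute Int_absorb)
  have "indep_set {X -` A \<inter> space M |A. A \<in> sets S} {Y -` A \<inter> space M |A. A \<in> sets T}"
  proof (rule indep_setI, safe)
    fix A C assume "A \<in> sets S" "C \<in> sets T"
    have "{\<omega> \<in> space M. X \<omega> \<in> A \<and> Y \<omega> \<in> C} = X -` A \<inter> space M \<inter> (Y -` C \<inter> space M)"
      "{\<omega> \<in> space M. X \<omega> \<in> A} = X -` A \<inter> space M" "{\<omega> \<in> space M. Y \<omega> \<in> C} = Y -` C \<inter> space M"
      by auto
    with eq[OF \<open>A \<in> sets S\<close> \<open>C \<in> sets T\<close>]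
    show "prob (X -` A \<inter> space M \<inter> (Y -` C \<inter> space M)) = prob (X -` A \<inter> space M) * prob (Y -` C \<inter> space M)"
      by simp
  qed (use assms(1,2) in \<open>auto simp: measurable_sets\<close>)
  then show ?thesis
    unfolding indep_var_eq using assms(1,2) by (auto intro!: indep_set_sigma_sets st)
qed

text \<open>Models one Brownian increment, with \<open>\<sigma> = sqrt (t - s)\<close>. Only the
  joint density is given, so the laws of the coordinates and their independence have to be
  derived.\<close>

locale gaussian_vector = prob_space M for M :: "'a measure" +
  fixes Y :: "'a \<Rightarrow> real^'m" and \<sigma> :: real
  assumes sigma_pos: "0 < \<sigma>"
    and law: "distributed M lborel Y (\<lambda>x. ennreal (\<Prod>i\<in>UNIV. normal_density 0 \<sigma> (x $ i)))"
begin

lemma measurable_vector [measurable]: "Y \<in> borel_measurable M"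
  using distributed_measurable[OF law] by simp

lemma measurable_coord [measurable]: "(\<lambda>\<omega>. Y \<omega> $ i) \<in> borel_measurable M"
  by (rule borel_measurable_vec_nth) measurable

text \<open>The density is a product, so Tonelli factorises the integral. Taking indicators in one
  or two coordinates and the constant 1 elsewhere then yields the marginals and pairwise
  independence, because the remaining factors integrate to 1.\<close>

lemma nn_integral_prod_coord:
  assumes [measurable]: "\<And>i. f i \<in> borel_measurable borel" and nn: "\<And>i x. 0 \<le> f i x"
  shows "(\<integral>\<^sup>+\<omega>. ennreal (\<Prod>i\<in>UNIV. f i (Y \<omega> $ i)) \<partial>M)
           = (\<Prod>i\<in>UNIV. \<integral>\<^sup>+x. ennreal (normal_density 0 \<sigma> x * f i x) \<partial>lborel)"
proof -
  have "(\<integral>\<^sup>+\<omega>. ennreal (\<Prod>i\<in>UNIV. f i (Y \<omega> $ i)) \<partial>M)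
      = (\<integral>\<^sup>+x. ennreal (\<Prod>i\<in>UNIV. normal_density 0 \<sigma> (x $ i)) * ennreal (\<Prod>i\<in>UNIV. f i (x $ i)) \<partial>lborel)"
    by (rule distributed_nn_integral[OF law, symmetric]) measurable
  also have "\<dots> = (\<integral>\<^sup>+x. ennreal (\<Prod>i\<in>UNIV. normal_density 0 \<sigma> (x $ i) * f i (x $ i)) \<partial>lborel)"
    by (simp add: prod.distrib ennreal_mult prod_nonneg nn)
  also have "\<dots> = (\<Prod>i\<in>UNIV. \<integral>\<^sup>+x. ennreal (normal_density 0 \<sigma> x * f i x) \<partial>lborel)"
    by (rule nn_integral_lborel_vec_prod) (auto simp: nn)
  finally show ?thesis .
qed

lemma nn_integral_normal_density: "(\<integral>\<^sup>+x. ennreal (normal_density 0 \<sigma> x) \<partial>lborel) = 1"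
  using sigma_pos by (subst nn_integral_eq_integral) auto

lemma emeasure_coord:
  assumes [measurable]: "A \<in> sets borel"
  shows "emeasure M {\<omega> \<in> space M. Y \<omega> $ i \<in> A}
           = (\<integral>\<^sup>+x. ennreal (normal_density 0 \<sigma> x) * indicator A x \<partial>lborel)"
proof -
  define f where "f k = (if k = i then indicator A else (\<lambda>_. 1) :: real \<Rightarrow> real)" for k
  have f [measurable]: "f k \<in> borel_measurable borel" "0 \<le> f k x" for k x
    unfolding f_def by auto
  have fp: "(\<Prod>k\<in>UNIV. f k (y $ k)) = indicator A (y $ i)" for y
    unfolding f_def by (subst prod.remove[of _ i]) auto
  have "emeasure M {\<omega> \<in> space M. Y \<omega> $ i \<in> A} = (\<integral>\<^sup>+\<omega>. indicator {\<omega> \<in> space M. Y \<omega> $ i \<in> A} \<omega> \<partial>M)"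
    by (rule nn_integral_indicator[symmetric]) measurable
  also have "\<dots> = (\<integral>\<^sup>+\<omega>. ennreal (\<Prod>k\<in>UNIV. f k (Y \<omega> $ k)) \<partial>M)"
    unfolding fp by (intro nn_integral_cong) (auto simp: indicator_def)
  also have "\<dots> = (\<Prod>k\<in>UNIV. \<integral>\<^sup>+x. ennreal (normal_density 0 \<sigma> x * f k x) \<partial>lborel)"
    by (rule nn_integral_prod_coord) (auto simp: f)
  also have "\<dots> = (\<integral>\<^sup>+x. ennreal (normal_density 0 \<sigma> x * indicator A x) \<partial>lborel)"
    unfolding f_def by (subst prod.remove[of _ i]) (auto simp: nn_integral_normal_density)
  finally show ?thesis by (simp add: ennreal_mult' ennreal_indicator)
qed

lemma distributed_coord: "distributed M lborel (\<lambda>\<omega>. Y \<omega> $ i) (normal_density 0 \<sigma>)"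
proof -
  have "distr M lborel (\<lambda>\<omega>. Y \<omega> $ i) = density lborel (normal_density 0 \<sigma>)"
  proof (rule measure_eqI)
    fix A assume "A \<in> sets (distr M lborel (\<lambda>\<omega>. Y \<omega> $ i))"
    then have A: "A \<in> sets borel" by simp
    have "(\<lambda>\<omega>. Y \<omega> $ i) -` A \<inter> space M = {\<omega> \<in> space M. Y \<omega> $ i \<in> A}" by auto
    then show "emeasure (distr M lborel (\<lambda>\<omega>. Y \<omega> $ i)) A = emeasure (density lborel (normal_density 0 \<sigma>)) A"
      using A by (simp add: emeasure_distr emeasure_density emeasure_coord)
  qed simp
  then show ?thesis by (simp add: distributed_def)
qed

lemma indep_coord:
  assumes ij: "i \<noteq> j"
  shows "indep_var borel (\<lambda>\<omega>. Y \<omega> $ i) borel (\<lambda>\<omega>. Y \<omega> $ j)"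
proof (rule indep_varI_prob)
  fix A C :: "real set" assume [measurable]: "A \<in> sets borel" "C \<in> sets borel"
  define f where "f k = (if k = i then indicator A else if k = j then indicator C else (\<lambda>_. 1) :: real \<Rightarrow> real)" for k
  have f [measurable]: "f k \<in> borel_measurable borel" "0 \<le> f k x" for k x
    unfolding f_def by auto
  have fp: "(\<Prod>k\<in>UNIV. f k (y $ k)) = indicator A (y $ i) * indicator C (y $ j)" for y
    unfolding f_def using ij by (subst prod.remove[of _ i], simp, simp, subst prod.remove[of _ j]) auto
  have "emeasure M {\<omega> \<in> space M. Y \<omega> $ i \<in> A \<and> Y \<omega> $ j \<in> C}
      = (\<integral>\<^sup>+\<omega>. indicator {\<omega> \<in> space M. Y \<omega> $ i \<in> A \<and> Y \<omega> $ j \<in> C} \<omega> \<partial>M)"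
    by (rule nn_integral_indicator[symmetric]) measurable
  also have "\<dots> = (\<integral>\<^sup>+\<omega>. ennreal (\<Prod>k\<in>UNIV. f k (Y \<omega> $ k)) \<partial>M)"
    unfolding fp by (intro nn_integral_cong) (auto simp: indicator_def)
  also have "\<dots> = (\<Prod>k\<in>UNIV. \<integral>\<^sup>+x. ennreal (normal_density 0 \<sigma> x * f k x) \<partial>lborel)"
    by (rule nn_integral_prod_coord) (auto simp: f)
  also have "\<dots> = (\<integral>\<^sup>+x. ennreal (normal_density 0 \<sigma> x * indicator A x) \<partial>lborel) *
      (\<integral>\<^sup>+x. ennreal (normal_density 0 \<sigma> x * indicator C x) \<partial>lborel)"
    unfolding f_def using ij
    by (subst prod.remove[of _ i], simp, simp, subst prod.remove[of _ j]) (auto simp: nn_integral_normal_density)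
  also have "\<dots> = emeasure M {\<omega> \<in> space M. Y \<omega> $ i \<in> A} * emeasure M {\<omega> \<in> space M. Y \<omega> $ j \<in> C}"
    by (simp add: emeasure_coord ennreal_mult' ennreal_indicator)
  finally show "prob {\<omega> \<in> space M. Y \<omega> $ i \<in> A \<and> Y \<omega> $ j \<in> C}
      = prob {\<omega> \<in> space M. Y \<omega> $ i \<in> A} * prob {\<omega> \<in> space M. Y \<omega> $ j \<in> C}"
    by (simp add: emeasure_eq_measure ennreal_mult'[symmetric])
qed measurable

text \<open>The shape \<open>(x - 0) ^ k\<close> is that of the library's central moments of a
  normal density, here with mean 0.\<close>

lemma moment_coord:
  assumes "has_bochner_integral lborel (\<lambda>x. normal_density 0 \<sigma> x * (x - 0) ^ k) c"
  shows "has_bochner_integral M (\<lambda>\<omega>. (Y \<omega> $ i) ^ k) c"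
  using assms distributed_integrable[OF distributed_coord, of "\<lambda>x. x ^ k" i]
    distributed_integral[OF distributed_coord, of "\<lambda>x. x ^ k" i]
  by (simp add: has_bochner_integral_iff)

lemma mean_coord: "has_bochner_integral M (\<lambda>\<omega>. Y \<omega> $ i) 0"
  using moment_coord[OF normal_moment_odd[OF sigma_pos, of _ 0], of i] by simp

text \<open>Needed for the term \<open>\<kappa> ^ 3 * b ^ 4\<close> that controls products of a
  Brownian and a Poisson increment.\<close>

lemma fourth_moment_coord: "has_bochner_integral M (\<lambda>\<omega>. (Y \<omega> $ i) ^ 4) (3 * (\<sigma>\<^sup>2)\<^sup>2)"
  using moment_coord[OF normal_moment_even[OF sigma_pos, of _ 2], of i]
  by (simp add: power2_eq_square fact_numeral mult.assoc)

lemma cov_coord: "has_bochner_integral M (\<lambda>\<omega>. Y \<omega> $ i * Y \<omega> $ j) (if i = j then \<sigma>\<^sup>2 else 0)"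
proof (cases "i = j")
  case True
  then show ?thesis
    using moment_coord[OF normal_moment_even[OF sigma_pos, of _ 1], of i] by (simp add: power2_eq_square)
next
  case False
  have "integrable M (\<lambda>\<omega>. Y \<omega> $ i)" "integrable M (\<lambda>\<omega>. Y \<omega> $ j)" "expectation (\<lambda>\<omega>. Y \<omega> $ i) = 0"
    using mean_coord by (auto simp: has_bochner_integral_iff)
  with False show ?thesis
    using indep_var_integrable[OF indep_coord[OF False]] indep_var_lebesgue_integral[OF indep_coord[OF False]]
    by (simp add: has_bochner_integral_iff)
qed

end

section \<open>Poisson moments and two inequalities dominating a product\<close>

lemma abs_mult_le_sum_squares: "\<bar>u * v\<bar> \<le> \<bar>u\<^sup>2 + v\<^sup>2\<bar>" for u v :: real
proof -
  have "2 * \<bar>u\<bar> * \<bar>v\<bar> \<le> u\<^sup>2 + v\<^sup>2" using sum_squares_bound[of "\<bar>u\<bar>" "\<bar>v\<bar>"] by simp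
  moreover have "0 \<le> \<bar>u\<bar> * \<bar>v\<bar>" by simp
  ultimately show ?thesis unfolding abs_mult by linarith
qed

text \<open>Both series come from (n+1) pmf(n+1) = c pmf(n); the index shift costs nothing because
  the terms at 0 vanish.\<close>

lemma sums_poisson_moment:
  fixes c :: real
  assumes "c > 0"
  shows "(\<lambda>n. real n * pmf (poisson_pmf c) n) sums c"
    and "(\<lambda>n. (real n)\<^sup>2 * pmf (poisson_pmf c) n) sums (c + c\<^sup>2)"
proof -
  have e: "(\<lambda>n. pmf (poisson_pmf c) n) sums 1"
    using sums_mult2[OF exp_converges[of c], of "exp (-c)"] assms
    by (simp add: field_simps exp_minus)
  have s: "real (Suc n) * pmf (poisson_pmf c) (Suc n) = c * pmf (poisson_pmf c) n" for n
    using assms by (simp add: divide_simps)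
  have "(\<lambda>n. real (Suc n) * pmf (poisson_pmf c) (Suc n)) sums c"
    unfolding s using sums_mult[OF e, of c] by simp
  then show 1: "(\<lambda>n. real n * pmf (poisson_pmf c) n) sums c"
    by (subst (asm) sums_Suc_iff) simp
  have s2: "(real (Suc n))\<^sup>2 * pmf (poisson_pmf c) (Suc n) = c * (real n * pmf (poisson_pmf c) n) + c * pmf (poisson_pmf c) n" for n
  proof -
    have "(real (Suc n))\<^sup>2 * pmf (poisson_pmf c) (Suc n) = real (Suc n) * (c * pmf (poisson_pmf c) n)"
      unfolding s[symmetric] by (simp only: power2_eq_square mult.assoc)
    then show ?thesis by (simp add: algebra_simps)
  qed
  have "(\<lambda>n. (real (Suc n))\<^sup>2 * pmf (poisson_pmf c) (Suc n)) sums (c + c\<^sup>2)"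
    unfolding s2 using sums_add[OF sums_mult[OF 1, of c] sums_mult[OF e, of c]]
    by (simp add: power2_eq_square add.commute)
  then show "(\<lambda>n. (real n)\<^sup>2 * pmf (poisson_pmf c) n) sums (c + c\<^sup>2)"
    by (subst (asm) sums_Suc_iff) simp
qed

lemma has_bochner_integral_nat_pmf:
  fixes f :: "nat \<Rightarrow> real"
  assumes "\<And>n. 0 \<le> f n" and "(\<lambda>n. f n * pmf q n) sums c"
  shows "has_bochner_integral (measure_pmf q) f c"
proof (rule has_bochner_integral_nn_integral)
  have c: "0 \<le> c" using assms by (intro sums_le[OF _ sums_zero assms(2)]) auto
  then show "0 \<le> c" .
  have "(\<integral>\<^sup>+ n. ennreal (f n) \<partial>measure_pmf q) = (\<Sum>n. ennreal (pmf q n * f n))"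
    by (simp add: nn_integral_measure_pmf nn_integral_count_space_nat ennreal_mult assms)
  also have "\<dots> = ennreal c"
    using assms by (intro suminf_ennreal_eq) (auto simp: mult.commute)
  finally show "(\<integral>\<^sup>+ n. ennreal (f n) \<partial>measure_pmf q) = ennreal c" .
qed (auto simp: assms)


text \<open>The gain over Cauchy--Schwarz, which would bound the covariation of the Brownian and the
  Poisson increment only to first order in the step: an integer \<open>n\<close> satisfies \<open>n \<le> n\<^sup>2\<close>, so
  \<open>\<bar>b\<bar> n \<le> n\<^sup>2 / \<kappa>\<close> as soon as \<open>\<bar>b\<bar> \<le> 1 / \<kappa>\<close>.\<close>

lemma abs_mult_Nats_le:
  fixes b n \<kappa> :: real
  assumes "n \<in> \<nat>" and \<kappa>: "0 < \<kappa>"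
  shows "\<bar>b * n\<bar> \<le> n\<^sup>2 / \<kappa> + \<kappa> ^ 3 * b ^ 4"
proof -
  from assms obtain k :: nat where k: "n = real k" by (auto elim: Nats_cases)
  have "real k \<le> real (k\<^sup>2)" unfolding of_nat_le_iff by (simp add: power2_eq_square)
  then have nn: "0 \<le> n" "n \<le> n\<^sup>2" unfolding k by auto
  show ?thesis
  proof (cases "\<bar>b\<bar> \<le> 1 / \<kappa>")
    case True
    then have "\<bar>b * n\<bar> \<le> 1 / \<kappa> * n\<^sup>2"
      unfolding abs_mult using nn \<kappa> by (intro mult_mono) auto
    moreover have "0 \<le> \<kappa> ^ 3 * b ^ 4" using \<kappa> by simp
    ultimately show ?thesis by simp
  next
    case False
    then have c: "1 \<le> \<kappa> * \<bar>b\<bar>" using \<kappa> by (simp add: field_simps)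
    have "0 \<le> (n - \<kappa> * \<bar>b\<bar>)\<^sup>2" by simp
    moreover have "0 \<le> n * (\<kappa> * \<bar>b\<bar>)" using nn \<kappa> by simp
    ultimately have "n * (\<kappa> * \<bar>b\<bar>) \<le> n\<^sup>2 + (\<kappa> * \<bar>b\<bar>)\<^sup>2" by (simp add: power2_diff)
    \<comment> \<open>For large \<open>b\<close> the quantity \<kappa>|b| is at least 1, so its
      square is at most its fourth power. The fourth moment of a Brownian increment is of second
      order in the step, which the square is not.\<close>
    also have "\<dots> \<le> n\<^sup>2 + (\<kappa> * \<bar>b\<bar>) ^ 4"
      using c by (intro add_left_mono power_increasing) auto
    also have "(\<kappa> * \<bar>b\<bar>) ^ 4 = \<kappa> * (\<kappa> ^ 3 * b ^ 4)"
      using power_Suc[of \<kappa> 3] by (simp add: power_mult_distrib power_even_abs)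
    also have "n\<^sup>2 + \<kappa> * (\<kappa> ^ 3 * b ^ 4) = \<kappa> * (n\<^sup>2 / \<kappa> + \<kappa> ^ 3 * b ^ 4)"
      using \<kappa> by (simp add: distrib_left)
    finally have "\<kappa> * (\<bar>b\<bar> * n) \<le> \<kappa> * (n\<^sup>2 / \<kappa> + \<kappa> ^ 3 * b ^ 4)" by (simp only: mult_ac)
    then have "\<bar>b\<bar> * n \<le> n\<^sup>2 / \<kappa> + \<kappa> ^ 3 * b ^ 4" using \<kappa> by (rule mult_left_le_imp_le)
    then show ?thesis using nn by (simp add: abs_mult)
  qed
qed

subsection \<open>Moments of Brownian and Poisson increments\<close>

locale brownian_poisson_space = prob_space M for M :: "'a measure" +
  fixes \<F> :: "real \<Rightarrow> 'a measure" and B :: "real \<Rightarrow> 'a \<Rightarrow> real ^ 'm"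
    and N :: "real \<Rightarrow> 'a \<Rightarrow> real" and lam :: real
  assumes filtration: "usual_filtration M \<F>"
    and brownian: "brownian_motion M \<F> B"
    and lam_pos: "0 < lam"
    and poisson: "poisson_process M \<F> lam N"
begin

lemma subalg: "0 \<le> s \<Longrightarrow> subalgebra M (\<F> s)"
  using filtration unfolding usual_filtration_def by blast

lemma past_measurable:
  "0 \<le> s \<Longrightarrow> X \<in> borel_measurable (\<F> s) \<Longrightarrow> X \<in> borel_measurable M"
  using measurable_from_subalg[OF subalg] by auto

lemma past_mono:
  assumes "0 \<le> s" "s \<le> t" "X \<in> borel_measurable (\<F> s)"
  shows "X \<in> borel_measurable (\<F> t)"
proof -
  have "subalgebra (\<F> t) (\<F> s)"
    using subalg[of s] subalg[of t] filtration assms(1,2)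
    unfolding usual_filtration_def subalgebra_def by (metis order_trans)
  then show ?thesis using assms(3) by (rule measurable_from_subalg)
qed

lemma B_past: "0 \<le> s \<Longrightarrow> s \<le> t \<Longrightarrow> B s \<in> borel_measurable (\<F> t)"
  using brownian past_mono unfolding brownian_motion_def by blast

lemma N_past: "0 \<le> s \<Longrightarrow> s \<le> t \<Longrightarrow> N s \<in> borel_measurable (\<F> t)"
  using poisson past_mono unfolding poisson_process_def by blast

lemma coord_incr_past:
  assumes "0 \<le> s" "s \<le> u" "u \<le> t"
  shows "(\<lambda>\<omega>. (B u \<omega> - B s \<omega>) $ i) \<in> borel_measurable (\<F> t)"
  by (intro borel_measurable_vec_nth borel_measurable_diff B_past) (use assms in auto)

lemma N_incr_past:
  assumes "0 \<le> s" "s \<le> u" "u \<le> t"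
  shows "(\<lambda>\<omega>. N u \<omega> - N s \<omega>) \<in> borel_measurable (\<F> t)"
  by (intro borel_measurable_diff N_past) (use assms in auto)

text \<open>Plays the role of conditioning on the past: \<xi> generates events of
  \<open>\<F> s\<close>, which are independent of \<open>Y\<close>, so expectations factor. Stating
  it with \<open>has_bochner_integral\<close> gives integrability and value at once, and long sums
  can be assembled by introduction rules.\<close>

lemma has_integral_past_mult:
  fixes f :: "'b::topological_space \<Rightarrow> real"
  assumes "0 \<le> s" and indep: "indep_of_past M (\<F> s) Y" and Y: "Y \<in> borel_measurable M"
    and \<xi>: "\<xi> \<in> borel_measurable (\<F> s)" and int: "integrable M \<xi>"
    and f: "f \<in> borel_measurable borel" and c: "has_bochner_integral M (\<lambda>\<omega>. f (Y \<omega>)) c"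
  shows "has_bochner_integral M (\<lambda>\<omega>. \<xi> \<omega> * f (Y \<omega>)) (expectation \<xi> * c)"
proof -
  have sp: "space (\<F> s) = space M" using subalg[OF \<open>0 \<le> s\<close>] by (simp add: subalgebra_def)
  have \<xi>M: "\<xi> \<in> borel_measurable M" using past_measurable[OF \<open>0 \<le> s\<close> \<xi>] .
  have fY: "(\<lambda>\<omega>. f (Y \<omega>)) \<in> borel_measurable M" using measurable_compose[OF Y f] .
  have "indep_var borel \<xi> borel (\<lambda>\<omega>. f (Y \<omega>))"
  proof (rule indep_varI_prob[OF \<xi>M fY])
    fix A C :: "real set" assume A: "A \<in> sets borel" and C: "C \<in> sets borel"
    have 1: "{\<omega> \<in> space M. \<xi> \<omega> \<in> A} \<in> sets (\<F> s)"
      using measurable_sets[OF \<xi> A] by (simp add: sp Collect_conj_eq vimage_def Int_commute)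
    have "f -` C \<in> sets borel" using measurable_sets[OF f C] by simp
    then have 2: "{\<omega> \<in> space M. f (Y \<omega>) \<in> C} \<in> {Y -` A \<inter> space M |A. A \<in> sets borel}"
      by (auto intro!: exI[of _ "f -` C"])
    have "{\<omega> \<in> space M. \<xi> \<omega> \<in> A \<and> f (Y \<omega>) \<in> C} = {\<omega> \<in> space M. \<xi> \<omega> \<in> A} \<inter> {\<omega> \<in> space M. f (Y \<omega>) \<in> C}"
      by auto
    then show "prob {\<omega> \<in> space M. \<xi> \<omega> \<in> A \<and> f (Y \<omega>) \<in> C}
        = prob {\<omega> \<in> space M. \<xi> \<omega> \<in> A} * prob {\<omega> \<in> space M. f (Y \<omega>) \<in> C}"
      using indep_setD[OF indep[unfolded indep_of_past_def] 1 2] by simp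
  qed
  then show ?thesis
    using indep_var_integrable[of \<xi> "\<lambda>\<omega>. f (Y \<omega>)"] indep_var_lebesgue_integral[of \<xi> "\<lambda>\<omega>. f (Y \<omega>)"] int c
    by (simp add: has_bochner_integral_iff)
qed

context
  fixes s t :: real
  assumes st: "0 \<le> s" "s < t"
begin

lemma B_incr:
  "indep_of_past M (\<F> s) (\<lambda>\<omega>. B t \<omega> - B s \<omega>)"
  "gaussian_vector M (\<lambda>\<omega>. B t \<omega> - B s \<omega>) (sqrt (t - s))"
  using brownian st prob_space_axioms
  unfolding brownian_motion_def gaussian_vector_def gaussian_vector_axioms_def by simp_all

lemma N_incr:
  "indep_of_past M (\<F> s) (\<lambda>\<omega>. N t \<omega> - N s \<omega>)"
  "distr M borel (\<lambda>\<omega>. N t \<omega> - N s \<omega>) = distr (measure_pmf (poisson_pmf (lam * (t - s)))) borel real"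
  using poisson st unfolding poisson_process_def by simp_all

lemma B_incr_measurable: "(\<lambda>\<omega>. B t \<omega> - B s \<omega>) \<in> borel_measurable M"
  using st by (intro past_measurable[of t] borel_measurable_diff B_past) auto

lemma N_incr_measurable: "(\<lambda>\<omega>. N t \<omega> - N s \<omega>) \<in> borel_measurable M"
  using st by (intro past_measurable[of t] borel_measurable_diff N_past) auto

text \<open>\<open>N\<close> is real-valued, so integrality is read off the law of the increment; it
  is what \<open>abs_mult_Nats_le\<close> requires.\<close>

lemma AE_N_incr: "AE \<omega> in M. N t \<omega> - N s \<omega> \<in> \<nat>"
proof -
  have "countable (\<nat> :: real set)" by (simp add: Nats_def)
  then have S: "(\<nat> :: real set) \<in> sets borel" by (rule sets.countable[rotated]) auto
  have "AE x in distr M borel (\<lambda>\<omega>. N t \<omega> - N s \<omega>). x \<in> \<nat>"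
    unfolding N_incr using S by (subst AE_distr_iff) auto
  then show ?thesis using S N_incr_measurable by (subst (asm) AE_distr_iff) auto
qed

lemma N_incr_moment:
  fixes f :: "real \<Rightarrow> real"
  assumes [measurable]: "f \<in> borel_measurable borel"
    and "\<And>n :: nat. 0 \<le> f n" "(\<lambda>n. f (real n) * pmf (poisson_pmf (lam * (t - s))) n) sums c"
  shows "has_bochner_integral M (\<lambda>\<omega>. f (N t \<omega> - N s \<omega>)) c"
proof -
  have "has_bochner_integral (measure_pmf (poisson_pmf (lam * (t - s)))) (\<lambda>n. f (real n)) c"
    using assms by (intro has_bochner_integral_nat_pmf) auto
  then have "has_bochner_integral (distr M borel (\<lambda>\<omega>. N t \<omega> - N s \<omega>)) f c"
    unfolding N_incr by (intro has_bochner_integral_distr) auto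
  then show ?thesis
    using N_incr_measurable by (simp add: has_bochner_integral_iff integrable_distr_eq integral_distr)
qed

context
  fixes \<xi> :: "'a \<Rightarrow> real"
  assumes \<xi>: "\<xi> \<in> borel_measurable (\<F> s)" "integrable M \<xi>"
begin

lemma past_mult_B_incr: "has_bochner_integral M (\<lambda>\<omega>. \<xi> \<omega> * (B t \<omega> - B s \<omega>) $ i) 0"
proof -
  have "(\<lambda>x :: real ^ 'm. x $ i) \<in> borel_measurable borel" by (rule borel_measurable_vec_nth) simp
  from has_integral_past_mult[OF st(1) B_incr(1) B_incr_measurable \<xi> this
      gaussian_vector.mean_coord[OF B_incr(2)]]
  show ?thesis by simp
qed

lemma past_mult_B_incr_prod:
  "has_bochner_integral M (\<lambda>\<omega>. \<xi> \<omega> * ((B t \<omega> - B s \<omega>) $ i * (B t \<omega> - B s \<omega>) $ j))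
     (expectation \<xi> * (if i = j then t - s else 0))"
proof -
  have "(\<lambda>x :: real ^ 'm. x $ i * x $ j) \<in> borel_measurable borel"
    by (intro borel_measurable_times borel_measurable_vec_nth) simp_all
  from has_integral_past_mult[OF st(1) B_incr(1) B_incr_measurable \<xi> this
      gaussian_vector.cov_coord[OF B_incr(2)]]
  show ?thesis using st(2) by (cases "i = j") simp_all
qed

lemma past_mult_B_incr_pow4:
  "has_bochner_integral M (\<lambda>\<omega>. \<xi> \<omega> * ((B t \<omega> - B s \<omega>) $ i) ^ 4) (expectation \<xi> * (3 * (t - s)\<^sup>2))"
proof -
  have "(\<lambda>x :: real ^ 'm. (x $ i) ^ 4) \<in> borel_measurable borel"
    by (intro borel_measurable_power borel_measurable_vec_nth) simp_all
  from has_integral_past_mult[OF st(1) B_incr(1) B_incr_measurable \<xi> this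
      gaussian_vector.fourth_moment_coord[OF B_incr(2)]]
  show ?thesis using st(2) by simp
qed

lemma past_mult_N_incr: "has_bochner_integral M (\<lambda>\<omega>. \<xi> \<omega> * (N t \<omega> - N s \<omega>)) (expectation \<xi> * (lam * (t - s)))"
proof (rule has_integral_past_mult[OF st(1) N_incr(1) N_incr_measurable \<xi>, where f = "\<lambda>x. x"])
  show "has_bochner_integral M (\<lambda>\<omega>. N t \<omega> - N s \<omega>) (lam * (t - s))"
    by (rule N_incr_moment[where f = "\<lambda>x. x"]) (use sums_poisson_moment(1)[of "lam * (t - s)"] st lam_pos in auto)
qed simp

lemma past_mult_N_incr_sq:
  "has_bochner_integral M (\<lambda>\<omega>. \<xi> \<omega> * (N t \<omega> - N s \<omega>)\<^sup>2)
     (expectation \<xi> * (lam * (t - s) + (lam * (t - s))\<^sup>2))"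
proof (rule has_integral_past_mult[OF st(1) N_incr(1) N_incr_measurable \<xi>, where f = "\<lambda>x. x\<^sup>2"])
  show "has_bochner_integral M (\<lambda>\<omega>. (N t \<omega> - N s \<omega>)\<^sup>2) (lam * (t - s) + (lam * (t - s))\<^sup>2)"
    by (rule N_incr_moment[where f = "\<lambda>x. x\<^sup>2"]) (use sums_poisson_moment(2)[of "lam * (t - s)"] st lam_pos in auto)
qed simp

end

end

text \<open>Dominated by |\<xi>| (b^2 + n^2), whose two parts have known moments.\<close>

lemma integrable_past_mult_B_N_incr:
  assumes st: "0 \<le> s" "s < t" and \<xi>: "\<xi> \<in> borel_measurable (\<F> s)" "integrable M \<xi>"
  shows "integrable M (\<lambda>\<omega>. \<xi> \<omega> * ((B t \<omega> - B s \<omega>) $ i * (N t \<omega> - N s \<omega>)))"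
proof (rule Bochner_Integration.integrable_bound)
  show "integrable M (\<lambda>\<omega>. \<xi> \<omega> * ((B t \<omega> - B s \<omega>) $ i * (B t \<omega> - B s \<omega>) $ i) + \<xi> \<omega> * (N t \<omega> - N s \<omega>)\<^sup>2)"
    using past_mult_B_incr_prod[OF st \<xi>] past_mult_N_incr_sq[OF st \<xi>] by (auto simp: has_bochner_integral_iff)
  show "(\<lambda>\<omega>. \<xi> \<omega> * ((B t \<omega> - B s \<omega>) $ i * (N t \<omega> - N s \<omega>))) \<in> borel_measurable M"
    using past_measurable[OF st(1) \<xi>(1)] N_incr_measurable[OF st] borel_measurable_vec_nth[OF B_incr_measurable[OF st]]
    by (intro borel_measurable_times)
  have "\<bar>b * n\<bar> \<le> \<bar>b * b + n\<^sup>2\<bar>" for b n :: real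
    using abs_mult_le_sum_squares[of b n] by (simp add: power2_eq_square)
  then show "AE \<omega> in M. norm (\<xi> \<omega> * ((B t \<omega> - B s \<omega>) $ i * (N t \<omega> - N s \<omega>)))
      \<le> norm (\<xi> \<omega> * ((B t \<omega> - B s \<omega>) $ i * (B t \<omega> - B s \<omega>) $ i) + \<xi> \<omega> * (N t \<omega> - N s \<omega>)\<^sup>2)"
    unfolding distrib_left[symmetric] real_norm_def abs_mult[of "\<xi> _"]
    by (intro AE_I2 mult_left_mono abs_ge_zero) (simp only: mult.assoc)
qed

text \<open>Integrates the pointwise bound \<open>abs_mult_Nats_le\<close> against |\<xi>|. The
  result has order \<delta>/\<kappa> + \<kappa>^3 \<delta>^2 for an interval of length \<delta> at
  most 1; \<kappa> stays free so that it can be tied to the mesh of a partition.\<close>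

lemma past_mult_B_N_incr_bound:
  assumes st: "0 \<le> s" "s < t" and \<xi>: "\<xi> \<in> borel_measurable (\<F> s)" "integrable M \<xi>" and \<kappa>: "0 < \<kappa>"
  shows "\<bar>expectation (\<lambda>\<omega>. \<xi> \<omega> * ((B t \<omega> - B s \<omega>) $ i * (N t \<omega> - N s \<omega>)))\<bar>
    \<le> expectation (\<lambda>\<omega>. \<bar>\<xi> \<omega>\<bar>) * ((lam * (t - s) + (lam * (t - s))\<^sup>2) / \<kappa> + \<kappa> ^ 3 * (3 * (t - s)\<^sup>2))"
proof -
  have a\<xi>: "(\<lambda>\<omega>. \<bar>\<xi> \<omega>\<bar>) \<in> borel_measurable (\<F> s)" "integrable M (\<lambda>\<omega>. \<bar>\<xi> \<omega>\<bar>)"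
    using \<xi> by auto
  have "\<bar>expectation (\<lambda>\<omega>. \<xi> \<omega> * ((B t \<omega> - B s \<omega>) $ i * (N t \<omega> - N s \<omega>)))\<bar>
      \<le> expectation (\<lambda>\<omega>. \<bar>\<xi> \<omega> * ((B t \<omega> - B s \<omega>) $ i * (N t \<omega> - N s \<omega>))\<bar>)"
    by (rule integral_abs_bound)
  also have "\<dots> \<le> expectation (\<lambda>\<omega>. \<bar>\<xi> \<omega>\<bar> * (N t \<omega> - N s \<omega>)\<^sup>2 / \<kappa> + \<kappa> ^ 3 * (\<bar>\<xi> \<omega>\<bar> * ((B t \<omega> - B s \<omega>) $ i) ^ 4))"
  proof (rule integral_mono_AE)
    show "AE \<omega> in M. \<bar>\<xi> \<omega> * ((B t \<omega> - B s \<omega>) $ i * (N t \<omega> - N s \<omega>))\<bar>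
        \<le> \<bar>\<xi> \<omega>\<bar> * (N t \<omega> - N s \<omega>)\<^sup>2 / \<kappa> + \<kappa> ^ 3 * (\<bar>\<xi> \<omega>\<bar> * ((B t \<omega> - B s \<omega>) $ i) ^ 4)"
      using AE_N_incr[OF st]
    proof eventually_elim
      case (elim \<omega>)
      have "\<bar>\<xi> \<omega> * (b * n)\<bar> \<le> \<bar>\<xi> \<omega>\<bar> * n\<^sup>2 / \<kappa> + \<kappa> ^ 3 * (\<bar>\<xi> \<omega>\<bar> * b ^ 4)" if "n \<in> \<nat>" for b n
        unfolding abs_mult[of "\<xi> \<omega>"]
        using mult_left_mono[OF abs_mult_Nats_le[OF that \<kappa>, of b], of "\<bar>\<xi> \<omega>\<bar>"]
        by (simp add: distrib_left mult_ac)
      then show ?case using elim by blast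
    qed
  qed (use integrable_past_mult_B_N_incr[OF st \<xi>] past_mult_N_incr_sq[OF st a\<xi>] past_mult_B_incr_pow4[OF st a\<xi>] in \<open>auto simp: has_bochner_integral_iff\<close>)
  also have "\<dots> = expectation (\<lambda>\<omega>. \<bar>\<xi> \<omega>\<bar>) * (lam * (t - s) + (lam * (t - s))\<^sup>2) / \<kappa>
      + \<kappa> ^ 3 * (expectation (\<lambda>\<omega>. \<bar>\<xi> \<omega>\<bar>) * (3 * (t - s)\<^sup>2))"
    using past_mult_N_incr_sq[OF st a\<xi>] past_mult_B_incr_pow4[OF st a\<xi>]
    by (intro has_bochner_integral_integral_eq has_bochner_integral_add
        has_bochner_integral_divide_zero has_bochner_integral_mult_right)
  finally show ?thesis by (simp add: distrib_left mult_ac)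
qed

text \<open>No independence of \<open>B\<close> and \<open>N\<close> is assumed: it has to come from the common filtration. Along a
  partition of \<open>[s, t]\<close> the off-diagonal products have mean zero by the independence of the past,
  and the diagonal ones are negligible as the mesh tends to zero.\<close>

lemma past_mult_B_N_incr:
  assumes st: "0 \<le> s" "s < t" and \<xi>: "\<xi> \<in> borel_measurable (\<F> s)" "integrable M \<xi>"
  shows "has_bochner_integral M (\<lambda>\<omega>. \<xi> \<omega> * ((B t \<omega> - B s \<omega>) $ i * (N t \<omega> - N s \<omega>))) 0"
proof -
  define e where "e = expectation (\<lambda>\<omega>. \<bar>\<xi> \<omega>\<bar>)"
  have e: "0 \<le> e" unfolding e_def by (intro Bochner_Integration.integral_nonneg) simp
  define T where "T = t - s"
  have T: "0 < T" using st by (simp add: T_def)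
  define J where "J v = expectation (\<lambda>\<omega>. \<xi> \<omega> * ((B v \<omega> - B s \<omega>) $ i * (N v \<omega> - N s \<omega>)))" for v
  \<comment> \<open>Extending the interval splits the product of increments into four: the old
    product, two mixed products of an earlier and a new increment, and the product \<open>I\<close>
    of the two new increments, the only one that adds to the bound.\<close>
  have step: "\<bar>J (u + \<delta>)\<bar> \<le> \<bar>J u\<bar> + e * ((lam * \<delta> + (lam * \<delta>)\<^sup>2) / \<kappa> + \<kappa> ^ 3 * (3 * \<delta>\<^sup>2))"
    if u: "s \<le> u" and \<delta>: "0 < \<delta>" and \<kappa>: "0 < \<kappa>" for u \<delta> \<kappa>
  proof -
    define v where "v = u + \<delta>"
    have uv: "0 \<le> u" "u < v" using u st \<delta> by (auto simp: v_def)
    have \<xi>u: "\<xi> \<in> borel_measurable (\<F> u)" by (rule past_mono[OF st(1) u \<xi>(1)])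
    \<comment> \<open>The moment facts require a nonempty interval, so the case
      \<open>u = s\<close>, where the increment is zero, is treated separately.\<close>
    have b: "has_bochner_integral M (\<lambda>\<omega>. \<xi> \<omega> * (B u \<omega> - B s \<omega>) $ i) 0"
      using past_mult_B_incr[OF st(1) _ \<xi>, of u i] u by (cases "u = s") (auto simp: has_bochner_integral_iff)
    have n: "integrable M (\<lambda>\<omega>. \<xi> \<omega> * (N u \<omega> - N s \<omega>))"
      using past_mult_N_incr[OF st(1) _ \<xi>, of u] u by (cases "u = s") (auto simp: has_bochner_integral_iff)
    have bn: "has_bochner_integral M (\<lambda>\<omega>. \<xi> \<omega> * ((B u \<omega> - B s \<omega>) $ i * (N u \<omega> - N s \<omega>))) (J u)"
      using integrable_past_mult_B_N_incr[OF st(1) _ \<xi>, of u i] u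
      by (cases "u = s") (auto simp: has_bochner_integral_iff J_def)
    \<comment> \<open>The factor known at time \<open>u\<close> now contains the earlier Brownian
      increment. Its mean is 0, which cancels the nonzero mean of the Poisson increment. In
      \<open>b'n\<close> the new Brownian increment supplies the zero, and the past factor only has
      to be integrable.\<close>
    have bn': "has_bochner_integral M (\<lambda>\<omega>. (\<xi> \<omega> * (B u \<omega> - B s \<omega>) $ i) * (N v \<omega> - N u \<omega>)) (0 * (lam * (v - u)))"
      using past_mult_N_incr[OF uv borel_measurable_times[OF \<xi>u coord_incr_past[OF st(1) u]], of i] b
      by (auto simp: has_bochner_integral_iff)
    have b'n: "has_bochner_integral M (\<lambda>\<omega>. (\<xi> \<omega> * (N u \<omega> - N s \<omega>)) * (B v \<omega> - B u \<omega>) $ i) 0"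
      using past_mult_B_incr[OF uv borel_measurable_times[OF \<xi>u N_incr_past[OF st(1) u]]] n by simp
    define I where "I = expectation (\<lambda>\<omega>. \<xi> \<omega> * ((B v \<omega> - B u \<omega>) $ i * (N v \<omega> - N u \<omega>)))"
    have b'n': "has_bochner_integral M (\<lambda>\<omega>. \<xi> \<omega> * ((B v \<omega> - B u \<omega>) $ i * (N v \<omega> - N u \<omega>))) I"
      using integrable_past_mult_B_N_incr[OF uv \<xi>u \<xi>(2)] by (simp add: has_bochner_integral_iff I_def)
    have "has_bochner_integral M (\<lambda>\<omega>. \<xi> \<omega> * ((B v \<omega> - B s \<omega>) $ i * (N v \<omega> - N s \<omega>))) (J u + 0 * (lam * (v - u)) + 0 + I)"
      using has_bochner_integral_add[OF has_bochner_integral_add[OF has_bochner_integral_add[OF bn bn'] b'n] b'n']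
      by (simp add: algebra_simps)
    then have "J v = J u + I" by (simp add: J_def has_bochner_integral_iff)
    moreover have "\<bar>I\<bar> \<le> e * ((lam * \<delta> + (lam * \<delta>)\<^sup>2) / \<kappa> + \<kappa> ^ 3 * (3 * \<delta>\<^sup>2))"
      using past_mult_B_N_incr_bound[OF uv \<xi>u \<xi>(2) \<kappa>, of i] by (simp add: I_def e_def v_def)
    ultimately show ?thesis by (simp add: v_def)
  qed
  have bound: "\<bar>J t\<bar> \<le> e * (lam * T + (lam * T)\<^sup>2 + 3 * T\<^sup>2) / real k" if k: "0 < k" for k :: nat
  proof -
    \<comment> \<open>With k^4 cells and \<kappa> = k, the dominant contributions k^4 \<delta> / k
      and k^4 k^3 \<delta>^2 are both of order 1/k, so the total tends to 0.\<close>
    define \<delta> where "\<delta> = T / real k ^ 4"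
    have \<delta>: "0 < \<delta>" using T k by (simp add: \<delta>_def)
    define w where "w = e * ((lam * \<delta> + (lam * \<delta>)\<^sup>2) / real k + real k ^ 3 * (3 * \<delta>\<^sup>2))"
    have "\<bar>J (s + real n * \<delta>)\<bar> \<le> real n * w" for n :: nat
    proof (induction n)
      case 0
      show ?case by (simp add: J_def)
    next
      case (Suc n)
      have "\<bar>J (s + real n * \<delta> + \<delta>)\<bar> \<le> \<bar>J (s + real n * \<delta>)\<bar> + w"
        unfolding w_def using \<delta> k by (intro step) auto
      with Suc show ?case by (simp add: algebra_simps)
    qed
    from this[of "k ^ 4"] have "\<bar>J t\<bar> \<le> real k ^ 4 * w"
      using k by (simp add: \<delta>_def T_def)
    also have "\<dots> = e * (lam * T + (lam * T)\<^sup>2 / real k ^ 4 + 3 * T\<^sup>2) / real k"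
      using k by (simp add: w_def \<delta>_def field_simps) (simp add: eval_nat_numeral field_simps)
    also have "\<dots> \<le> e * (lam * T + (lam * T)\<^sup>2 + 3 * T\<^sup>2) / real k"
    proof -
      have "1 \<le> real k ^ 4" using k by (intro one_le_power) simp
      then have "(lam * T)\<^sup>2 / real k ^ 4 \<le> (lam * T)\<^sup>2"
        using mult_left_mono[of 1 "real k ^ 4" "(lam * T)\<^sup>2"] k by (simp add: divide_le_eq)
      then show ?thesis by (intro divide_right_mono mult_left_mono[OF _ e]) auto
    qed
    finally show ?thesis .
  qed
  have "\<bar>J t\<bar> \<le> 0"
  proof (rule LIMSEQ_le_const[OF lim_const_over_n])
    show "\<exists>K. \<forall>k\<ge>K. \<bar>J t\<bar> \<le> e * (lam * T + (lam * T)\<^sup>2 + 3 * T\<^sup>2) / real k"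
      using bound by (intro exI[of _ 1]) auto
  qed
  then show ?thesis
    using integrable_past_mult_B_N_incr[OF st \<xi>, of i] by (simp add: has_bochner_integral_iff J_def)
qed

text \<open>Each past factor is multiplied by a noise moment: the Brownian covariance
  \<open>(t - s) I\<close>, the Poisson mean \<open>lam * (t - s)\<close> and the Poisson second
  moment. Terms linear in the Brownian increment, including those multiplied by the Poisson
  increment, contribute nothing.\<close>

lemma has_integral_second_moment_step:
  fixes a h :: "'a \<Rightarrow> real ^ 'd" and g :: "'a \<Rightarrow> real ^ 'm ^ 'd"
  assumes st: "0 \<le> s" "s < t"
    and meas: "a \<in> borel_measurable (\<F> s)" "g \<in> borel_measurable (\<F> s)" "h \<in> borel_measurable (\<F> s)"
    and int: "integrable M (\<lambda>\<omega>. (norm (a \<omega>))\<^sup>2)" "integrable M (\<lambda>\<omega>. (norm (g \<omega>))\<^sup>2)"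
      "integrable M (\<lambda>\<omega>. (norm (h \<omega>))\<^sup>2)"
  shows "has_bochner_integral M
      (\<lambda>\<omega>. (norm (a \<omega> + g \<omega> *v (B t \<omega> - B s \<omega>) + (N t \<omega> - N s \<omega>) *\<^sub>R h \<omega>))\<^sup>2)
      (expectation (\<lambda>\<omega>. (norm (a \<omega>))\<^sup>2 + (t - s) * (norm (g \<omega>))\<^sup>2
        + (lam * (t - s) + (lam * (t - s))\<^sup>2) * (norm (h \<omega>))\<^sup>2 + 2 * (lam * (t - s)) * (a \<omega> \<bullet> h \<omega>)))"
proof -
  have norm_sq: "(norm x)\<^sup>2 = (\<Sum>r\<in>UNIV. (x $ r)\<^sup>2)" for x :: "real ^ 'n"
    unfolding power2_norm_eq_inner inner_vec_def by (simp add: power2_eq_square)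
  have norm_sq_mat: "(norm A)\<^sup>2 = (\<Sum>r\<in>UNIV. \<Sum>j\<in>UNIV. (A $ r $ j)\<^sup>2)" for A :: "real ^ 'm ^ 'd"
    unfolding power2_norm_eq_inner inner_vec_def by (simp add: power2_eq_square)
  have measF: "(\<lambda>\<omega>. a \<omega> $ r) \<in> borel_measurable (\<F> s)" "(\<lambda>\<omega>. g \<omega> $ r $ j) \<in> borel_measurable (\<F> s)"
    "(\<lambda>\<omega>. h \<omega> $ r) \<in> borel_measurable (\<F> s)" for r j
    using meas by (auto intro!: borel_measurable_vec_nth)
  have comp_le: "(x $ r)\<^sup>2 \<le> (norm x)\<^sup>2" for x :: "real ^ 'n" and r
    using power_mono[OF component_le_norm_cart[of x r], of 2] by simp
  have comp_le_mat: "(A $ r $ j)\<^sup>2 \<le> (norm A)\<^sup>2" for A :: "real ^ 'm ^ 'd" and r j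
    using power_mono[OF order_trans[OF component_le_norm_cart[of "A $ r" j]
      Finite_Cartesian_Product.norm_nth_le[of A r]], of 2] by simp
  have sq: "integrable M (\<lambda>\<omega>. (x \<omega>)\<^sup>2)"
    if "x \<in> borel_measurable (\<F> s)" "integrable M y" "\<And>\<omega>. (x \<omega>)\<^sup>2 \<le> y \<omega>" for x y :: "'a \<Rightarrow> real"
    using that(2) borel_measurable_power[OF past_measurable[OF st(1) that(1)]]
  proof (rule Bochner_Integration.integrable_bound)
    show "AE \<omega> in M. norm ((x \<omega>)\<^sup>2) \<le> norm (y \<omega>)"
      using that(3) by (auto intro: order_trans[OF _ abs_ge_self])
  qed
  have intF: "integrable M (\<lambda>\<omega>. (a \<omega> $ r)\<^sup>2)" "integrable M (\<lambda>\<omega>. (g \<omega> $ r $ j)\<^sup>2)"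
    "integrable M (\<lambda>\<omega>. (h \<omega> $ r)\<^sup>2)" for r j
    by (rule sq[OF measF(1) int(1) comp_le], rule sq[OF measF(2) int(2) comp_le_mat],
        rule sq[OF measF(3) int(3) comp_le])
  have prod: "integrable M (\<lambda>\<omega>. x \<omega> * y \<omega>)"
    if "x \<in> borel_measurable (\<F> s)" "y \<in> borel_measurable (\<F> s)"
      "integrable M (\<lambda>\<omega>. (x \<omega>)\<^sup>2)" "integrable M (\<lambda>\<omega>. (y \<omega>)\<^sup>2)" for x y :: "'a \<Rightarrow> real"
  proof (rule Bochner_Integration.integrable_bound[OF Bochner_Integration.integrable_add[OF that(3,4)]])
    show "(\<lambda>\<omega>. x \<omega> * y \<omega>) \<in> borel_measurable M"
      using that(1,2) past_measurable[OF st(1)] by (intro borel_measurable_times) auto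
    show "AE \<omega> in M. norm (x \<omega> * y \<omega>) \<le> norm ((x \<omega>)\<^sup>2 + (y \<omega>)\<^sup>2)" by (intro AE_I2) (simp only: real_norm_def abs_mult_le_sum_squares)
  qed
  let ?b = "\<lambda>\<omega>. B t \<omega> - B s \<omega>" and ?n = "\<lambda>\<omega>. N t \<omega> - N s \<omega>"
  \<comment> \<open>Sorted by noise factor: every summand is a past-measurable scalar times one of
    1, n, n^2, b_j, b_j b_k, b_j n, the shapes covered by the \<open>past_mult\<close>
    facts.\<close>
  let ?S = "\<lambda>\<omega> r. ((a \<omega> $ r)\<^sup>2 + 2 * (a \<omega> $ r * h \<omega> $ r * ?n \<omega>) + (h \<omega> $ r)\<^sup>2 * (?n \<omega>)\<^sup>2)
      + ((\<Sum>j\<in>UNIV. 2 * (a \<omega> $ r * g \<omega> $ r $ j * ?b \<omega> $ j))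
      + (\<Sum>j\<in>UNIV. \<Sum>k\<in>UNIV. g \<omega> $ r $ j * g \<omega> $ r $ k * (?b \<omega> $ j * ?b \<omega> $ k))
      + (\<Sum>j\<in>UNIV. 2 * (g \<omega> $ r $ j * h \<omega> $ r * (?b \<omega> $ j * ?n \<omega>))))"
  have expand: "(norm (a \<omega> + g \<omega> *v ?b \<omega> + ?n \<omega> *\<^sub>R h \<omega>))\<^sup>2 = (\<Sum>r\<in>UNIV. ?S \<omega> r)" for \<omega>
  proof -
    have "(\<alpha> + (\<Sum>j\<in>UNIV. \<beta> j * b j) + n * \<eta>)\<^sup>2
      = (\<alpha>\<^sup>2 + 2 * (\<alpha> * \<eta> * n) + \<eta>\<^sup>2 * n\<^sup>2)
        + ((\<Sum>j\<in>UNIV. 2 * (\<alpha> * \<beta> j * b j)) + (\<Sum>j\<in>UNIV. \<Sum>k\<in>UNIV. \<beta> j * \<beta> k * (b j * b k))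
        + (\<Sum>j\<in>UNIV. 2 * (\<beta> j * \<eta> * (b j * n))))" for \<alpha> \<eta> n :: real and \<beta> b :: "'m \<Rightarrow> real"
    proof -
      define S where "S = (\<Sum>j\<in>UNIV. \<beta> j * b j)"
      have 1: "(\<Sum>j\<in>UNIV. 2 * (\<alpha> * \<beta> j * b j)) = 2 * \<alpha> * S" and 3: "(\<Sum>j\<in>UNIV. 2 * (\<beta> j * \<eta> * (b j * n))) = 2 * \<eta> * n * S"
        by (simp_all add: S_def sum_distrib_left mult_ac)
      have 2: "(\<Sum>j\<in>UNIV. \<Sum>k\<in>UNIV. \<beta> j * \<beta> k * (b j * b k)) = S * S"
        by (simp add: S_def sum_product mult_ac)
      show ?thesis unfolding 1 2 3 S_def[symmetric] by (simp add: power2_eq_square algebra_simps)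
    qed
    then show ?thesis
      unfolding norm_sq by (simp add: matrix_vector_mult_def)
  qed
  define V where "V r = expectation (\<lambda>\<omega>. (a \<omega> $ r)\<^sup>2) + (\<Sum>j\<in>UNIV. (t - s) * expectation (\<lambda>\<omega>. (g \<omega> $ r $ j)\<^sup>2))
       + (lam * (t - s) + (lam * (t - s))\<^sup>2) * expectation (\<lambda>\<omega>. (h \<omega> $ r)\<^sup>2)
       + 2 * (lam * (t - s)) * expectation (\<lambda>\<omega>. a \<omega> $ r * h \<omega> $ r)" for r
  have "has_bochner_integral M (\<lambda>\<omega>. ?S \<omega> r) (V r)" for r
  proof -
    \<comment> \<open>Mirrors \<open>?S\<close> summand by summand, zeros included, so that the
      introduction rules match syntactically; only afterwards is it simplified to
      \<open>V r\<close>.\<close>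
    let ?W = "(expectation (\<lambda>\<omega>. (a \<omega> $ r)\<^sup>2) + 2 * (expectation (\<lambda>\<omega>. a \<omega> $ r * h \<omega> $ r) * (lam * (t - s)))
        + expectation (\<lambda>\<omega>. (h \<omega> $ r)\<^sup>2) * (lam * (t - s) + (lam * (t - s))\<^sup>2))
      + ((\<Sum>j\<in>(UNIV :: 'm set). 2 * 0)
      + (\<Sum>j\<in>UNIV. \<Sum>k\<in>UNIV. expectation (\<lambda>\<omega>. g \<omega> $ r $ j * g \<omega> $ r $ k) * (if j = k then t - s else 0))
      + (\<Sum>j\<in>(UNIV :: 'm set). 2 * 0))"
    have "(\<Sum>k\<in>UNIV. x k * (if j = k then t - s else 0)) = (t - s) * x j" for x and j :: 'm
      by (simp add: if_distrib[of "(*) _"] cong: if_cong)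
    then have "?W = V r"
      by (simp add: V_def power2_eq_square[of "_ $ _"])
    moreover have "has_bochner_integral M (\<lambda>\<omega>. ?S \<omega> r) ?W"
      by (intro has_bochner_integral_add has_bochner_integral_sum has_bochner_integral_mult_right
        past_mult_B_incr[OF st] past_mult_B_incr_prod[OF st] past_mult_N_incr[OF st] past_mult_N_incr_sq[OF st] past_mult_B_N_incr[OF st]
        has_bochner_integral_integrable intF prod borel_measurable_times borel_measurable_power measF)
    ultimately show ?thesis by simp
  qed
  then have "has_bochner_integral M (\<lambda>\<omega>. \<Sum>r\<in>UNIV. ?S \<omega> r) (\<Sum>r\<in>UNIV. V r)"
    by (rule has_bochner_integral_sum)
  \<comment> \<open>The expectation in the claim is expanded in the same coordinates and reaches the
    same sum of the \<open>V r\<close>.\<close>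
  moreover have "has_bochner_integral M (\<lambda>\<omega>. \<Sum>r\<in>UNIV. (a \<omega> $ r)\<^sup>2 + (\<Sum>j\<in>UNIV. (t - s) * (g \<omega> $ r $ j)\<^sup>2)
       + (lam * (t - s) + (lam * (t - s))\<^sup>2) * (h \<omega> $ r)\<^sup>2
       + 2 * (lam * (t - s)) * (a \<omega> $ r * h \<omega> $ r))
     (\<Sum>r\<in>UNIV. V r)"
    unfolding V_def
    by (intro has_bochner_integral_add has_bochner_integral_sum has_bochner_integral_mult_right
        has_bochner_integral_integrable intF prod measF)
  then have "expectation (\<lambda>\<omega>. (norm (a \<omega>))\<^sup>2 + (t - s) * (norm (g \<omega>))\<^sup>2
        + (lam * (t - s) + (lam * (t - s))\<^sup>2) * (norm (h \<omega>))\<^sup>2 + 2 * (lam * (t - s)) * (a \<omega> \<bullet> h \<omega>))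
     = (\<Sum>r\<in>UNIV. V r)"
    unfolding norm_sq norm_sq_mat inner_vec_def sum_distrib_left sum.distrib[symmetric]
    by (simp only: has_bochner_integral_integral_eq inner_real_def)
  ultimately show ?thesis unfolding expand by simp
qed

end

subsection \<open>Truncated coefficients and the one-step drift\<close>

text \<open>Obtained from 0 \<le> |t u - v|^2 after division by t.\<close>

lemma norm_add_sq_young:
  fixes u v :: "'b::real_inner"
  assumes "0 < t"
  shows "(norm (u + v))\<^sup>2 \<le> (1 + t) * (norm u)\<^sup>2 + (1 + inverse t) * (norm v)\<^sup>2"
proof -
  have "0 \<le> (norm (t *\<^sub>R u - v))\<^sup>2" by simp
  then have "t * (2 * (u \<bullet> v)) \<le> t * (t * (u \<bullet> u)) + v \<bullet> v"
    unfolding power2_norm_eq_inner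
    by (simp add: inner_diff_left inner_diff_right inner_commute[of v u] algebra_simps)
  moreover have "v \<bullet> v = t * (inverse t * (v \<bullet> v))" using assms by simp
  ultimately have "t * (2 * (u \<bullet> v)) \<le> t * (t * (u \<bullet> u) + inverse t * (v \<bullet> v))"
    unfolding distrib_left by linarith
  then have "2 * (u \<bullet> v) \<le> t * (u \<bullet> u) + inverse t * (v \<bullet> v)"
    using assms by (rule mult_left_le_imp_le)
  then show ?thesis
    by (simp add: power2_norm_eq_inner inner_add_left inner_add_right inner_commute[of v u] algebra_simps)
qed

text \<open>The weights are 1 + \<theta> and 1 + 1/\<theta> for finite positive \<theta>. In the two
  degenerate cases one diffusion part vanishes and both weights can be 1, so later arguments need no
  case distinction on \<theta>.\<close>

lemma split_dissipative_unified:
  assumes "split_dissipative F1 F G1 G \<theta> \<alpha>1 \<alpha>2 \<beta>1 \<beta>2"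
  obtains c1 c2 where "0 \<le> c2"
    and "\<And>x y. (norm (G1 x + G y))\<^sup>2 \<le> c1 * (norm (G1 x))\<^sup>2 + c2 * (norm (G y))\<^sup>2"
    and "\<And>x. 2 * (x \<bullet> F1 x) + c1 * (norm (G1 x))\<^sup>2 \<le> \<alpha>1 - \<beta>1 * (norm x)\<^sup>2"
    and "\<And>x. 2 * (x \<bullet> F x) + c2 * (norm (G x))\<^sup>2 \<le> \<alpha>2 + \<beta>2 * (norm x)\<^sup>2"
  using assms unfolding split_dissipative_def
proof (elim disjE exE conjE)
  fix t :: real
  assume "0 < t"
    "\<forall>x. 2 * (x \<bullet> F1 x) + (1 + t) * (norm (G1 x))\<^sup>2 \<le> \<alpha>1 - \<beta>1 * (norm x)\<^sup>2"
    "\<forall>x. 2 * (x \<bullet> F x) + (1 + inverse t) * (norm (G x))\<^sup>2 \<le> \<alpha>2 + \<beta>2 * (norm x)\<^sup>2"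
  then show ?thesis
    \<comment> \<open>Instantiation follows the order of occurrence in the obtained facts, hence
      \<open>c2\<close> comes before \<open>c1\<close>.\<close>
    using norm_add_sq_young[of t] by (intro that[of "1 + inverse t" "1 + t"]) auto
next
  assume "\<forall>x. G x = 0" "\<forall>x. 2 * (x \<bullet> F1 x) + (norm (G1 x))\<^sup>2 \<le> \<alpha>1 - \<beta>1 * (norm x)\<^sup>2"
    "\<forall>x. 2 * (x \<bullet> F x) \<le> \<alpha>2 + \<beta>2 * (norm x)\<^sup>2"
  then show ?thesis by (intro that[of 1 1]) auto
next
  assume "\<forall>x. G1 x = 0" "\<forall>x. 2 * (x \<bullet> F1 x) \<le> \<alpha>1 - \<beta>1 * (norm x)\<^sup>2"
    "\<forall>x. 2 * (x \<bullet> F x) + (norm (G x))\<^sup>2 \<le> \<alpha>2 + \<beta>2 * (norm x)\<^sup>2"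
  then show ?thesis by (intro that[of 1 1]) auto
qed

lemma trunc_map_eq: "norm x \<le> trunc_radius \<mu> \<phi> \<Delta> \<Longrightarrow> trunc_map \<mu> \<phi> \<Delta> x = x"
  by (cases "x = 0") (auto simp: trunc_map_def sgn_div_norm)

lemma norm_trunc_map: "0 \<le> trunc_radius \<mu> \<phi> \<Delta> \<Longrightarrow> norm (trunc_map \<mu> \<phi> \<Delta> x) \<le> trunc_radius \<mu> \<phi> \<Delta>"
  by (simp add: trunc_map_def norm_sgn)

text \<open>Beyond the truncation radius \<open>R\<close>, \<open>x\<close> is \<open>norm x / R\<close> times its truncation, and this factor
  lies between \<open>1\<close> and its square.\<close>

lemma truncated_dissipative:
  fixes F :: "real ^ 'd \<Rightarrow> real ^ 'd" and G :: "real ^ 'd \<Rightarrow> real ^ 'm ^ 'd"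
  assumes "0 \<le> c2" "0 \<le> \<alpha>2" "0 \<le> \<beta>2"
    and diss: "\<And>x. 2 * (x \<bullet> F x) + c2 * (norm (G x))\<^sup>2 \<le> \<alpha>2 + \<beta>2 * (norm x)\<^sup>2"
    and R: "R = trunc_radius \<mu> \<phi> \<Delta>" "0 < R"
  shows "2 * (x \<bullet> F (trunc_map \<mu> \<phi> \<Delta> x)) + c2 * (norm (G (trunc_map \<mu> \<phi> \<Delta> x)))\<^sup>2
           \<le> \<alpha>2 + (\<beta>2 + \<alpha>2 / R\<^sup>2) * (norm x)\<^sup>2"
proof (cases "norm x \<le> R")
  case True
  have "0 \<le> \<alpha>2 / R\<^sup>2 * (norm x)\<^sup>2" using assms by simp
  with diss[of x] True show ?thesis by (simp add: trunc_map_eq R(1) distrib_right)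
next
  case False
  define q where "q = norm x / R"
  have q: "1 \<le> q" "norm x = q * R" using False R(2) by (auto simp: q_def)
  define y where "y = trunc_map \<mu> \<phi> \<Delta> x"
  have "x \<noteq> 0" using False R(2) by auto
  then have x: "x = q *\<^sub>R y" and y: "norm y = R"
    using False R(2) by (auto simp: y_def q_def trunc_map_def sgn_div_norm R(1)[symmetric])
  have "2 * (x \<bullet> F y) + c2 * (norm (G y))\<^sup>2 \<le> q * (2 * (y \<bullet> F y) + c2 * (norm (G y))\<^sup>2)"
    using mult_right_mono[OF q(1), of "c2 * (norm (G y))\<^sup>2"] assms(1) by (subst x) (simp add: distrib_left)
  also have "\<dots> \<le> q * (\<alpha>2 + \<beta>2 * R\<^sup>2)"
    using diss[of y] q(1) by (intro mult_left_mono) (auto simp: y)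
  also have "\<dots> \<le> q\<^sup>2 * (\<alpha>2 + \<beta>2 * R\<^sup>2)"
    using q(1) assms by (intro mult_right_mono) (auto simp: power2_eq_square)
  \<comment> \<open>The extra \<alpha>2 only brings this case to the form valid inside the
    truncation radius; q^2 \<alpha>2 is the source of the term
    \<open>\<alpha>2 / R\<^sup>2\<close>.\<close>
  also have "\<dots> \<le> \<alpha>2 + q\<^sup>2 * (\<alpha>2 + \<beta>2 * R\<^sup>2)" using assms by simp
  also have "\<dots> = \<alpha>2 + (\<beta>2 + \<alpha>2 / R\<^sup>2) * (norm x)\<^sup>2"
    using R(2) by (simp add: q(2) power_mult_distrib field_simps)
  finally show ?thesis by (simp add: y_def)
qed

lemma norm_sq_add_le: "(norm (u + v))\<^sup>2 \<le> 2 * (norm u)\<^sup>2 + 2 * (norm (v :: 'b::real_inner))\<^sup>2"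
  using norm_add_sq_young[of 1 u v] by simp

lemma linear_growth_sq:
  assumes "norm u \<le> K * (1 + norm x)"
  shows "(norm u)\<^sup>2 \<le> 2 * K\<^sup>2 * (1 + (norm x)\<^sup>2)"
proof -
  have "(norm u)\<^sup>2 \<le> (K * (1 + norm x))\<^sup>2" using assms by (intro power_mono) auto
  also have "\<dots> \<le> K\<^sup>2 * (2 * (1 + (norm x)\<^sup>2))"
    unfolding power_mult_distrib using sum_squares_bound[of 1 "norm x"]
    by (intro mult_left_mono) (auto simp: power2_sum)
  finally show ?thesis by (simp add: algebra_simps)
qed

text \<open>The left side is what one step of the second moment integrates. Its part of first order
  in \<Delta> is handled by dissipativity and linear growth of \<open>h\<close>; \<open>w\<close>
  stands for the squared truncation level \<phi>(\<Delta>)^2.\<close>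

lemma one_step_drift:
  fixes x f h :: "'b::real_inner" and g :: "'c::real_inner"
  assumes diss: "2 * (x \<bullet> f) + (norm g)\<^sup>2 \<le> \<alpha> - (\<beta> - \<epsilon> / 2) * (norm x)\<^sup>2"
    and f: "(norm f)\<^sup>2 \<le> 4 * K\<^sup>2 * (1 + (norm x)\<^sup>2) + 2 * w" and w: "\<Delta> * w \<le> sqrt \<Delta>"
    and h: "norm h \<le> K * (1 + norm x)"
    and K: "0 < K" and lam: "0 < lam" and eps: "0 < \<epsilon>" and \<Delta>: "0 < \<Delta>" "\<Delta> \<le> 1"
    and small: "(8 * K\<^sup>2 + 4 * lam\<^sup>2 * K\<^sup>2 + 4) * sqrt \<Delta> \<le> \<epsilon> / 2"
  shows "(norm (x + \<Delta> *\<^sub>R f))\<^sup>2 + \<Delta> * (norm g)\<^sup>2 + (lam * \<Delta> + (lam * \<Delta>)\<^sup>2) * (norm h)\<^sup>2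
           + 2 * (lam * \<Delta>) * ((x + \<Delta> *\<^sub>R f) \<bullet> h)
         \<le> (1 - (\<beta> - 2 * lam * K * (2 + K) - \<epsilon>) * \<Delta>) * (norm x)\<^sup>2 + (\<alpha> + 2 * lam * K * (2 + K) + \<epsilon>) * \<Delta>"
proof -
  define n where "n = (norm x)\<^sup>2"
  have n: "0 \<le> n" by (simp add: n_def)
  have h2: "(norm h)\<^sup>2 \<le> 2 * K\<^sup>2 * (1 + n)" using linear_growth_sq[OF h] by (simp add: n_def)
  have xh: "2 * (x \<bullet> h) \<le> K * (1 + 3 * n)"
  proof -
    have "x \<bullet> h \<le> norm x * norm h" by (rule norm_cauchy_schwarz)
    also have "\<dots> \<le> norm x * (K * (1 + norm x))" using h by (intro mult_left_mono) auto
    finally have "2 * (x \<bullet> h) \<le> K * (2 * norm x + 2 * n)" by (simp add: n_def power2_eq_square algebra_simps)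
    also have "\<dots> \<le> K * (1 + 3 * n)"
      using sum_squares_bound[of 1 "norm x"] K by (intro mult_left_mono) (auto simp: n_def)
    finally show ?thesis .
  qed
  have "0 \<le> K * n" using K n by simp
  \<comment> \<open>Origin of the constant: |h|^2 contributes 2 K^2 (1 + n), and 2 x.h at most K (1
    + 3 n), hence at most 4 K (1 + n).\<close>
  have jump: "lam * (norm h)\<^sup>2 + 2 * lam * (x \<bullet> h) \<le> 2 * lam * K * (2 + K) * (1 + n)"
  proof -
    have "(norm h)\<^sup>2 + 2 * (x \<bullet> h) \<le> 2 * K * (2 + K) * (1 + n)"
      using h2 xh K \<open>0 \<le> K * n\<close> by (simp add: algebra_simps power2_eq_square)
    then have "lam * ((norm h)\<^sup>2 + 2 * (x \<bullet> h)) \<le> lam * (2 * K * (2 + K) * (1 + n))"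
      using lam by (intro mult_left_mono) auto
    then show ?thesis by (simp add: algebra_simps)
  qed
  have sq: "\<Delta> \<le> sqrt \<Delta>" using \<Delta> by (simp add: real_le_rsqrt power2_eq_square mult_left_le)
  \<comment> \<open>The summand \<epsilon>/2 is slack: the argument gives \<epsilon>/2 * (1 + n).
    Adding it makes the constant term increase by exactly \<epsilon>, the amount by which the decay
    rate drops.\<close>
  have rest: "\<Delta> * (norm (f + lam *\<^sub>R h))\<^sup>2 \<le> \<epsilon> / 2 * (1 + n) + \<epsilon> / 2"
  proof -
    have "(norm (f + lam *\<^sub>R h))\<^sup>2 \<le> 2 * (norm f)\<^sup>2 + 2 * lam\<^sup>2 * (norm h)\<^sup>2"
      using norm_sq_add_le[of f "lam *\<^sub>R h"] by (simp add: power_mult_distrib)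
    also have "\<dots> \<le> 2 * (4 * K\<^sup>2 * (1 + n) + 2 * w) + 2 * lam\<^sup>2 * (2 * K\<^sup>2 * (1 + n))"
      using f h2 by (intro add_mono mult_left_mono) (auto simp: n_def)
    also have "\<dots> = (8 * K\<^sup>2 + 4 * lam\<^sup>2 * K\<^sup>2) * (1 + n) + 4 * w" by (simp add: algebra_simps)
    finally have "\<Delta> * (norm (f + lam *\<^sub>R h))\<^sup>2 \<le> \<Delta> * ((8 * K\<^sup>2 + 4 * lam\<^sup>2 * K\<^sup>2) * (1 + n) + 4 * w)"
      using \<Delta> by (intro mult_left_mono) auto
    also have "\<dots> = \<Delta> * ((8 * K\<^sup>2 + 4 * lam\<^sup>2 * K\<^sup>2) * (1 + n)) + 4 * (\<Delta> * w)" by (simp add: algebra_simps)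
    also have "\<dots> \<le> sqrt \<Delta> * ((8 * K\<^sup>2 + 4 * lam\<^sup>2 * K\<^sup>2) * (1 + n)) + 4 * sqrt \<Delta>"
      using w sq n by (intro add_mono mult_right_mono) auto
    also have "\<dots> \<le> (8 * K\<^sup>2 + 4 * lam\<^sup>2 * K\<^sup>2 + 4) * sqrt \<Delta> * (1 + n)"
      using \<Delta> n by (simp add: algebra_simps)
    also have "\<dots> \<le> \<epsilon> / 2 * (1 + n)" using small n by (intro mult_right_mono) auto
    finally show ?thesis using eps by simp
  qed
  have "(norm (x + \<Delta> *\<^sub>R f))\<^sup>2 + \<Delta> * (norm g)\<^sup>2 + (lam * \<Delta> + (lam * \<Delta>)\<^sup>2) * (norm h)\<^sup>2
           + 2 * (lam * \<Delta>) * ((x + \<Delta> *\<^sub>R f) \<bullet> h)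
      = n + \<Delta> * ((2 * (x \<bullet> f) + (norm g)\<^sup>2) + (lam * (norm h)\<^sup>2 + 2 * lam * (x \<bullet> h))
        + \<Delta> * (norm (f + lam *\<^sub>R h))\<^sup>2)"
    unfolding n_def power2_norm_eq_inner
    by (simp add: inner_add_left inner_add_right inner_commute[of f x] inner_commute[of h f]
        power2_eq_square algebra_simps)
  also have "\<dots> \<le> n + \<Delta> * ((\<alpha> - (\<beta> - \<epsilon> / 2) * n) + 2 * lam * K * (2 + K) * (1 + n) + (\<epsilon> / 2 * (1 + n) + \<epsilon> / 2))"
    using diss jump rest \<Delta> by (intro add_left_mono mult_left_mono add_mono) (auto simp: n_def)
  also have "\<dots> = (1 - (\<beta> - 2 * lam * K * (2 + K) - \<epsilon>) * \<Delta>) * n + (\<alpha> + 2 * lam * K * (2 + K) + \<epsilon>) * \<Delta>"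
    by (simp add: field_simps)
  finally show ?thesis by (simp add: n_def)
qed

text \<open>The excess over the fixed point \<open>c\<close> shrinks by the factor 1 - \<rho> per
  step. The bound \<rho> \<le> 1 keeps this factor nonnegative, so the induction hypothesis may be
  multiplied by it.\<close>

lemma limsup_ennreal_affine_recursion:
  fixes e :: "nat \<Rightarrow> real"
  assumes rec: "\<And>k. e (Suc k) \<le> (1 - \<rho>) * e k + \<rho> * c" and \<rho>: "0 < \<rho>" "\<rho> \<le> 1"
  shows "limsup (\<lambda>k. ennreal (e k)) \<le> ennreal c"
proof -
  have *: "e k \<le> c + (1 - \<rho>) ^ k * (e 0 - c)" for k
  proof (induction k)
    case (Suc k)
    have "e (Suc k) \<le> (1 - \<rho>) * (c + (1 - \<rho>) ^ k * (e 0 - c)) + \<rho> * c"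
      using rec[of k] mult_left_mono[OF Suc, of "1 - \<rho>"] \<rho> by simp
    then show ?case by (simp add: algebra_simps)
  qed simp
  have "(\<lambda>k. (1 - \<rho>) ^ k) \<longlonglongrightarrow> 0" using \<rho> by (intro LIMSEQ_realpow_zero) auto
  then have "(\<lambda>k. c + (1 - \<rho>) ^ k * (e 0 - c)) \<longlonglongrightarrow> c + 0 * (e 0 - c)"
    by (intro tendsto_add tendsto_mult tendsto_const)
  then have "(\<lambda>k. ennreal (c + (1 - \<rho>) ^ k * (e 0 - c))) \<longlonglongrightarrow> ennreal c"
    by (intro tendsto_ennrealI) simp
  then have "limsup (\<lambda>k. ennreal (c + (1 - \<rho>) ^ k * (e 0 - c))) = ennreal c"
    by (intro lim_imp_Limsup) auto
  moreover have "limsup (\<lambda>k. ennreal (e k)) \<le> limsup (\<lambda>k. ennreal (c + (1 - \<rho>) ^ k * (e 0 - c)))"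
    by (intro Limsup_mono always_eventually allI ennreal_leI *)
  ultimately show ?thesis by simp
qed


section \<open>Regularity of the coefficients and size of the truncated parts\<close>

lemma rpow_mono: "0 \<le> \<gamma> \<Longrightarrow> 0 \<le> a \<Longrightarrow> a \<le> b \<Longrightarrow> rpow a \<gamma> \<le> rpow b \<gamma>"
  by (simp add: rpow_def powr_mono2)

text \<open>On the unit ball around a point the polynomial factor is bounded by a constant.
  Continuity serves to make the truncated coefficients Borel measurable.\<close>

lemma continuous_on_poly_lipschitz:
  fixes F :: "real ^ 'd \<Rightarrow> 'b::real_normed_vector"
  assumes "0 < L" "0 \<le> \<gamma>"
    and lip: "\<And>x y. norm (F x - F y) \<le> L * (1 + rpow (norm x) \<gamma> + rpow (norm y) \<gamma>) * norm (x - y)"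
  shows "continuous_on UNIV F"
proof (rule continuous_at_imp_continuous_on, rule ballI)
  fix x :: "real ^ 'd"
  let ?C = "L * (1 + rpow (norm x + 1) \<gamma> + rpow (norm x) \<gamma>)"
  have "\<forall>\<^sub>F y in at x. norm (F y - F x) \<le> ?C * norm (y - x)"
  proof -
    have "norm (F y - F x) \<le> ?C * norm (y - x)" if "dist y x < 1" for y
    proof -
      have "norm y \<le> norm x + 1"
        using norm_triangle_sub[of y x] that by (simp add: dist_norm)
      then have "rpow (norm y) \<gamma> \<le> rpow (norm x + 1) \<gamma>" using assms by (intro rpow_mono) auto
      then have "L * (1 + rpow (norm y) \<gamma> + rpow (norm x) \<gamma>) * norm (y - x) \<le> ?C * norm (y - x)"
        using assms by (intro mult_right_mono mult_left_mono) auto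
      with lip[of y x] show ?thesis by linarith
    qed
    then show ?thesis unfolding eventually_at by (intro exI[of _ 1]) auto
  qed
  moreover have "((\<lambda>y. ?C * norm (y - x)) \<longlongrightarrow> ?C * norm (x - x)) (at x)" by (intro tendsto_intros)
  then have "((\<lambda>y. ?C * norm (y - x)) \<longlongrightarrow> 0) (at x)" by simp
  ultimately have "((\<lambda>y. F y - F x) \<longlongrightarrow> 0) (at x)" by (rule Lim_null_comparison)
  then show "isCont F x" unfolding isCont_def by (rule LIM_zero_cancel)
qed

lemma borel_measurable_matrix_vector_mult:
  fixes A :: "'c \<Rightarrow> real ^ 'm ^ 'd"
  assumes "A \<in> borel_measurable M" "y \<in> borel_measurable M"
  shows "(\<lambda>\<omega>. A \<omega> *v y \<omega>) \<in> borel_measurable M"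
proof (subst borel_measurable_euclidean_space, rule ballI)
  fix b :: "real ^ 'd" assume "b \<in> Basis"
  then obtain r where b: "b = axis r 1" by (auto simp: Basis_vec_def)
  have "(\<lambda>\<omega>. \<Sum>j\<in>UNIV. A \<omega> $ r $ j * y \<omega> $ j) \<in> borel_measurable M"
    using assms by (intro borel_measurable_sum borel_measurable_times borel_measurable_vec_nth)
  then show "(\<lambda>\<omega>. (A \<omega> *v y \<omega>) \<bullet> b) \<in> borel_measurable M"
    by (simp add: b inner_axis matrix_vector_mult_def)
qed

lemma borel_measurable_trunc_map: "trunc_map \<mu> \<phi> \<Delta> \<in> borel_measurable borel"
proof -
  have "(\<lambda>x :: real ^ 'd. min (norm x) (trunc_radius \<mu> \<phi> \<Delta>) *\<^sub>R (x /\<^sub>R norm x)) \<in> borel_measurable borel"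
    by measurable
  then show ?thesis by (simp add: trunc_map_def[abs_def] sgn_div_norm)
qed

lemma trunc_radius_image:
  assumes "truncation_rate p \<mu> \<phi>" "0 < \<Delta>" "\<Delta> \<le> 1"
  shows "0 \<le> trunc_radius \<mu> \<phi> \<Delta>" "\<mu> (trunc_radius \<mu> \<phi> \<Delta>) = \<phi> \<Delta>"
proof -
  have *: "\<phi> \<Delta> \<in> \<mu> ` {0..}" using assms unfolding truncation_rate_def by auto
  show "0 \<le> trunc_radius \<mu> \<phi> \<Delta>" "\<mu> (trunc_radius \<mu> \<phi> \<Delta>) = \<phi> \<Delta>"
    using inv_into_into[OF *] f_inv_into_f[OF *] by (auto simp: trunc_radius_def)
qed

text \<open>A radius at most \<open>c\<close> would give \<phi>(\<Delta>) = \<mu>(R) \<le> \<mu>(max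
  c 0), which fails once \<phi>(\<Delta>) is large. The maximum with 0 is there because \<mu> is
  monotone on the nonnegative half-line only.\<close>

lemma eventually_trunc_radius_gt:
  assumes gc: "growth_control F G \<mu>" and tr: "truncation_rate p \<mu> \<phi>"
  shows "\<forall>\<^sub>F \<Delta> in at_right 0. c < trunc_radius \<mu> \<phi> \<Delta>"
proof -
  have "filterlim \<phi> at_top (at_right 0)" using tr by (simp add: truncation_rate_def)
  then have "\<forall>\<^sub>F \<Delta> in at_right 0. \<mu> (max c 0) < \<phi> \<Delta>" by (simp add: filterlim_at_top_dense)
  moreover have "\<forall>\<^sub>F \<Delta> in at_right (0::real). \<Delta> \<in> {0<..<1}" by (rule eventually_at_right_real) simp
  ultimately show ?thesis
  proof eventually_elim
    case (elim \<Delta>)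
    have R: "0 \<le> trunc_radius \<mu> \<phi> \<Delta>" "\<mu> (trunc_radius \<mu> \<phi> \<Delta>) = \<phi> \<Delta>"
      using trunc_radius_image[OF tr] elim by auto
    have "strict_mono_on {0..} \<mu>" using gc by (simp add: growth_control_def)
    then have "\<mu> (trunc_radius \<mu> \<phi> \<Delta>) \<le> \<mu> (max c 0)" if "trunc_radius \<mu> \<phi> \<Delta> \<le> max c 0"
      using that R(1) by (auto intro: strict_mono_on_leD)
    then show ?case using R(2) elim by (metis max.bounded_iff max.coboundedI1 not_less)
  qed
qed

text \<open>Truncated arguments lie in the ball of radius R, where the coefficients are bounded by
  \<mu>(R) = \<phi>(\<Delta>); the control by \<mu> is available from radius 1 on.\<close>

lemma norm_truncated_le:
  fixes F :: "real ^ 'd \<Rightarrow> real ^ 'd" and G :: "real ^ 'd \<Rightarrow> real ^ 'm ^ 'd"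
  assumes "growth_control F G \<mu>" "truncation_rate p \<mu> \<phi>" "0 < \<Delta>" "\<Delta> \<le> 1" "1 \<le> trunc_radius \<mu> \<phi> \<Delta>"
  shows "norm (F (trunc_map \<mu> \<phi> \<Delta> x)) \<le> \<phi> \<Delta>" "norm (G (trunc_map \<mu> \<phi> \<Delta> x)) \<le> \<phi> \<Delta>"
proof -
  have "norm (trunc_map \<mu> \<phi> \<Delta> x) \<le> trunc_radius \<mu> \<phi> \<Delta>" using assms(5) by (intro norm_trunc_map) simp
  then have "max (norm (F (trunc_map \<mu> \<phi> \<Delta> x))) (norm (G (trunc_map \<mu> \<phi> \<Delta> x))) \<le> \<mu> (trunc_radius \<mu> \<phi> \<Delta>)"
    using assms(1,5) unfolding growth_control_def by blast
  then show "norm (F (trunc_map \<mu> \<phi> \<Delta> x)) \<le> \<phi> \<Delta>" "norm (G (trunc_map \<mu> \<phi> \<Delta> x)) \<le> \<phi> \<Delta>"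
    by (simp_all add: trunc_radius_image[OF assms(2-4)])
qed

text \<open>Taking p-th roots in the second part of the rate condition gives \<phi>(\<Delta>) \<le>
  \<Delta>^(-1/4).\<close>

lemma step_times_truncation_sq_le:
  assumes tr: "truncation_rate p \<mu> \<phi>" and p: "0 < p" and \<Delta>: "0 < \<Delta>" "\<Delta> \<le> 1"
  shows "\<Delta> * (\<phi> \<Delta>)\<^sup>2 \<le> sqrt \<Delta>"
proof -
  have \<phi>: "0 < \<phi> \<Delta>" "\<phi> \<Delta> powr p \<le> \<Delta> powr (- p / 4)"
    using tr \<Delta> by (auto simp: truncation_rate_def)
  have "\<phi> \<Delta> = (\<phi> \<Delta> powr p) powr (1 / p)" using \<phi> p by (simp add: powr_powr)
  also have "\<dots> \<le> (\<Delta> powr (- p / 4)) powr (1 / p)" using \<phi> p by (intro powr_mono2) auto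
  also have "\<dots> = \<Delta> powr (- 1 / 4)" using p by (simp add: powr_powr)
  finally have "(\<phi> \<Delta>)\<^sup>2 \<le> (\<Delta> powr (- 1 / 4))\<^sup>2" using \<phi> by (intro power_mono) auto
  also have "\<dots> = \<Delta> powr (- 1 / 2)" by (simp add: power2_eq_square flip: powr_add)
  finally have "\<Delta> * (\<phi> \<Delta>)\<^sup>2 \<le> \<Delta> powr 1 * \<Delta> powr (- 1 / 2)" using \<Delta> by (simp add: mult_left_mono)
  also have "\<dots> = \<Delta> powr (1 / 2)" by (subst powr_add[symmetric]) simp
  also have "\<dots> = sqrt \<Delta>" using \<Delta> by (simp add: powr_half_sqrt)
  finally show ?thesis .
qed

lemma part_trunc_growth:
  fixes A1 A :: "real ^ 'd \<Rightarrow> 'b::real_inner"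
  assumes "norm (A1 x) \<le> K * (1 + norm x)" "norm (A (trunc_map \<mu> \<phi> \<Delta> x)) \<le> v"
  shows "(norm (part_trunc \<mu> \<phi> \<Delta> A1 A x))\<^sup>2 \<le> 4 * K\<^sup>2 * (1 + (norm x)\<^sup>2) + 2 * v\<^sup>2"
proof -
  have "(norm (A (trunc_map \<mu> \<phi> \<Delta> x)))\<^sup>2 \<le> v\<^sup>2" using assms(2) by (intro power_mono) auto
  with linear_growth_sq[OF assms(1)] norm_sq_add_le[of "A1 x" "A (trunc_map \<mu> \<phi> \<Delta> x)"]
  show ?thesis by (simp add: part_trunc_def)
qed

lemma borel_measurable_part_trunc:
  fixes A1 A :: "real ^ 'd \<Rightarrow> 'b::euclidean_space"
  assumes "continuous_on UNIV A1" "continuous_on UNIV A"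
  shows "part_trunc \<mu> \<phi> \<Delta> A1 A \<in> borel_measurable borel"
  unfolding part_trunc_def[abs_def]
  by (intro borel_measurable_add borel_measurable_continuous_onI assms
      measurable_compose[OF borel_measurable_trunc_map])

subsection \<open>Second moments of the scheme\<close>

context brownian_poisson_space
begin

text \<open>Adaptedness and square integrability are carried through the induction because the
  one-step formula presupposes both. Here \<open>p\<close> and \<open>q\<close> are the factor and
  the offset of the recursion. \<open>C\<close> enters only through integrability, so it may depend
  on \<Delta>.\<close>

lemma euler_maruyama_second_moment:
  fixes X :: "nat \<Rightarrow> 'a \<Rightarrow> real ^ 'd" and f h :: "real ^ 'd \<Rightarrow> real ^ 'd" and g :: "real ^ 'd \<Rightarrow> real ^ 'm ^ 'd"
  assumes \<Delta>: "0 < \<Delta>" and X0: "X 0 = (\<lambda>\<omega>. x0)"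
    and XS: "\<And>k. X (Suc k) = (\<lambda>\<omega>. X k \<omega> + \<Delta> *\<^sub>R f (X k \<omega>)
        + g (X k \<omega>) *v (B (real (Suc k) * \<Delta>) \<omega> - B (real k * \<Delta>) \<omega>)
        + (N (real (Suc k) * \<Delta>) \<omega> - N (real k * \<Delta>) \<omega>) *\<^sub>R h (X k \<omega>))"
    and meas: "f \<in> borel_measurable borel" "g \<in> borel_measurable borel" "h \<in> borel_measurable borel"
    and growth: "\<And>x. (norm (f x))\<^sup>2 \<le> C * (1 + (norm x)\<^sup>2)" "\<And>x. (norm (g x))\<^sup>2 \<le> C * (1 + (norm x)\<^sup>2)"
      "\<And>x. (norm (h x))\<^sup>2 \<le> C * (1 + (norm x)\<^sup>2)"
    and pq: "0 \<le> p" "0 \<le> q"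
    and drift: "\<And>x. (norm (x + \<Delta> *\<^sub>R f x))\<^sup>2 + \<Delta> * (norm (g x))\<^sup>2
        + (lam * \<Delta> + (lam * \<Delta>)\<^sup>2) * (norm (h x))\<^sup>2 + 2 * (lam * \<Delta>) * ((x + \<Delta> *\<^sub>R f x) \<bullet> h x)
        \<le> p * (norm x)\<^sup>2 + q"
  shows "X k \<in> borel_measurable (\<F> (real k * \<Delta>)) \<and> integrable M (\<lambda>\<omega>. (norm (X k \<omega>))\<^sup>2)" (is "?P k")
    and "expectation (\<lambda>\<omega>. (norm (X (Suc k) \<omega>))\<^sup>2) \<le> p * expectation (\<lambda>\<omega>. (norm (X k \<omega>))\<^sup>2) + q"
proof -
  have step: "?P (Suc k) \<and> expectation (\<lambda>\<omega>. (norm (X (Suc k) \<omega>))\<^sup>2) \<le> p * expectation (\<lambda>\<omega>. (norm (X k \<omega>))\<^sup>2) + q"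
    if P: "?P k" for k
  proof -
    define s t where "s = real k * \<Delta>" and "t = real (Suc k) * \<Delta>"
    have st: "0 \<le> s" "s < t" and ts: "t - s = \<Delta>"
      using \<Delta> by (auto simp: s_def t_def algebra_simps)
    have X: "X k \<in> borel_measurable (\<F> s)" and intX: "integrable M (\<lambda>\<omega>. (norm (X k \<omega>))\<^sup>2)"
      using P by (auto simp: s_def)
    note mX = measurable_compose[OF X meas(1)] measurable_compose[OF X meas(2)] measurable_compose[OF X meas(3)]
    have ma: "(\<lambda>\<omega>. X k \<omega> + \<Delta> *\<^sub>R f (X k \<omega>)) \<in> borel_measurable (\<F> s)"
      using X mX by simp
    have dom: "integrable M (\<lambda>\<omega>. (norm (Y \<omega>))\<^sup>2)"
      if "Y \<in> borel_measurable (\<F> s)" "\<And>\<omega>. (norm (Y \<omega>))\<^sup>2 \<le> D * (1 + (norm (X k \<omega>))\<^sup>2)"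
      for Y :: "'a \<Rightarrow> 'c::euclidean_space" and D
    proof (rule Bochner_Integration.integrable_bound)
      show "integrable M (\<lambda>\<omega>. D * (1 + (norm (X k \<omega>))\<^sup>2))" using intX by simp
      show "(\<lambda>\<omega>. (norm (Y \<omega>))\<^sup>2) \<in> borel_measurable M"
        using past_measurable[OF st(1) that(1)] by simp
      show "AE \<omega> in M. norm ((norm (Y \<omega>))\<^sup>2) \<le> norm (D * (1 + (norm (X k \<omega>))\<^sup>2))"
        using that(2) by (auto intro: order_trans[OF _ abs_ge_self])
    qed
    have ia: "integrable M (\<lambda>\<omega>. (norm (X k \<omega> + \<Delta> *\<^sub>R f (X k \<omega>)))\<^sup>2)"
    proof (rule dom[OF ma])
      fix \<omega>
      have "(norm (X k \<omega> + \<Delta> *\<^sub>R f (X k \<omega>)))\<^sup>2 \<le> 2 * (norm (X k \<omega>))\<^sup>2 + 2 * (\<Delta>\<^sup>2 * (norm (f (X k \<omega>)))\<^sup>2)"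
        using norm_sq_add_le[of "X k \<omega>" "\<Delta> *\<^sub>R f (X k \<omega>)"] by (simp add: power_mult_distrib)
      also have "\<dots> \<le> 2 * (1 + (norm (X k \<omega>))\<^sup>2) + 2 * (\<Delta>\<^sup>2 * (C * (1 + (norm (X k \<omega>))\<^sup>2)))"
        using growth(1) by (intro add_mono mult_left_mono) auto
      finally show "(norm (X k \<omega> + \<Delta> *\<^sub>R f (X k \<omega>)))\<^sup>2 \<le> (2 + 2 * \<Delta>\<^sup>2 * C) * (1 + (norm (X k \<omega>))\<^sup>2)"
        by (simp add: algebra_simps)
    qed
    have ig: "integrable M (\<lambda>\<omega>. (norm (g (X k \<omega>)))\<^sup>2)" and ih: "integrable M (\<lambda>\<omega>. (norm (h (X k \<omega>)))\<^sup>2)"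
      by (rule dom[OF mX(2) growth(2)], rule dom[OF mX(3) growth(3)])
    note S = has_integral_second_moment_step[OF st ma mX(2,3) ia ig ih, unfolded ts]
    have XS': "X (Suc k) = (\<lambda>\<omega>. X k \<omega> + \<Delta> *\<^sub>R f (X k \<omega>) + g (X k \<omega>) *v (B t \<omega> - B s \<omega>)
        + (N t \<omega> - N s \<omega>) *\<^sub>R h (X k \<omega>))"
      unfolding XS s_def t_def ..
    have noise: "B s \<in> borel_measurable (\<F> t)" "B t \<in> borel_measurable (\<F> t)"
      "N s \<in> borel_measurable (\<F> t)" "N t \<in> borel_measurable (\<F> t)"
      using st by (auto intro: B_past N_past)
    note past = past_mono[OF st(1) less_imp_le[OF st(2)] X] past_mono[OF st(1) less_imp_le[OF st(2)] mX(1)]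
      past_mono[OF st(1) less_imp_le[OF st(2)] mX(2)] past_mono[OF st(1) less_imp_le[OF st(2)] mX(3)]
    have "X (Suc k) \<in> borel_measurable (\<F> t)"
      unfolding XS' by (intro borel_measurable_add borel_measurable_scaleR borel_measurable_const
          borel_measurable_matrix_vector_mult borel_measurable_diff noise past)
    moreover have "integrable M (\<lambda>\<omega>. (norm (X (Suc k) \<omega>))\<^sup>2)"
      unfolding XS' using S by (simp add: has_bochner_integral_iff)
    moreover have "expectation (\<lambda>\<omega>. (norm (X (Suc k) \<omega>))\<^sup>2) \<le> expectation (\<lambda>\<omega>. p * (norm (X k \<omega>))\<^sup>2 + q)"
      unfolding XS' has_bochner_integral_integral_eq[OF S]
      \<comment> \<open>Monotonicity in this form asks for an integrable nonnegative majorant;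
        nonnegativity is where \<open>0 \<le> p\<close> and \<open>0 \<le> q\<close> are
        used.\<close>
      using intX pq by (intro integral_mono' drift) auto
    moreover have "expectation (\<lambda>\<omega>. p * (norm (X k \<omega>))\<^sup>2 + q) = p * expectation (\<lambda>\<omega>. (norm (X k \<omega>))\<^sup>2) + q"
      using intX by (simp add: prob_space)
    ultimately show ?thesis by (simp add: t_def)
  qed
  show P: "?P k" for k
  proof (induction k)
    case 0
    show ?case by (simp add: X0)
  next
    case (Suc k)
    then show ?case using step by blast
  qed
  show "expectation (\<lambda>\<omega>. (norm (X (Suc k) \<omega>))\<^sup>2) \<le> p * expectation (\<lambda>\<omega>. (norm (X k \<omega>))\<^sup>2) + q"
    using step[OF P] by blast
qed

end

section \<open>Choice of the step threshold and conclusion\<close>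

theorem theorem4p7:
  fixes M :: "'a measure" and \<F> :: "real \<Rightarrow> 'a measure"
    and B :: "real \<Rightarrow> 'a \<Rightarrow> real ^ 'm" and N :: "real \<Rightarrow> 'a \<Rightarrow> real"
    and F1 F h :: "real ^ 'd \<Rightarrow> real ^ 'd"
    and G1 G :: "real ^ 'd \<Rightarrow> real ^ 'm ^ 'd"
    and \<mu> \<phi> :: "real \<Rightarrow> real"
    and lam L1 \<gamma> K1 r L2 p K2 \<alpha>1 \<alpha>2 \<beta>1 \<beta>2 \<epsilon> :: real and \<theta> :: ereal
  assumes "prob_space M" and "complete_measure M" and "usual_filtration M \<F>"
    and "brownian_motion M \<F> B"
    and "lam > 0" and "poisson_process M \<F> lam N"
    (* (i) *)
    and "L1 > 0" and "\<gamma> \<ge> 0" and "K1 > 0"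
    and "\<And>x y. max (max (norm (F1 x - F1 y)) (norm (G1 x - G1 y))) (norm (h x - h y))
                  \<le> L1 * norm (x - y)"
    and "\<And>x y. max (norm (F x - F y)) (norm (G x - G y))
                  \<le> L1 * (1 + rpow (norm x) \<gamma> + rpow (norm y) \<gamma>) * norm (x - y)"
    and "\<And>x. max (max (norm (F1 x)) (norm (G1 x))) (norm (h x)) \<le> K1 * (1 + norm x)"
    (* (ii) *)
    and "r > 2" and "L2 > 0"
    and "\<And>x y. (x - y) \<bullet> (F x - F y) + (r - 1) / 2 * (norm (G x - G y))\<^sup>2
                  \<le> L2 * (norm (x - y))\<^sup>2"
    (* (iii) *)
    and "p > r" and "K2 > 0"
    and "\<And>x. x \<bullet> F x + (p - 1) / 2 * (norm (G x))\<^sup>2 \<le> K2 * (1 + (norm x)\<^sup>2)"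
    (* (iv) *)
    and "\<alpha>1 > 0" and "\<alpha>2 > 0" and "\<beta>2 > 0"
    and "\<beta>1 > \<beta>2 + max (lam * (4 * K1\<^sup>2 + 1)) (2 * lam * K1 * (2 + K1))"
    and "split_dissipative F1 F G1 G \<theta> \<alpha>1 \<alpha>2 \<beta>1 \<beta>2"
    (* truncation functions *)
    and "growth_control F G \<mu>" and "truncation_rate p \<mu> \<phi>"
    and "0 < \<epsilon>"
    and "\<epsilon> < \<beta>1 - \<beta>2 - max (lam * (4 * K1\<^sup>2 + 1)) (2 * lam * K1 * (2 + K1))"
  shows "\<exists>\<Delta>h\<in>{0<..<1}. \<forall>\<Delta>\<in>{0<..<\<Delta>h}. \<forall>x0 :: real ^ 'd.
           limsup (\<lambda>k. \<integral>\<^sup>+ \<omega>. ennreal ((norm (pt_EM F1 F G1 G h \<mu> \<phi> B N \<Delta> x0 k \<omega>))\<^sup>2) \<partial>M)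
             \<le> ennreal ((\<alpha>1 + \<alpha>2 + 2 * lam * K1 * (2 + K1) + \<epsilon>)
                        / (\<beta>1 - \<beta>2 - 2 * lam * K1 * (2 + K1) - \<epsilon>))"
proof -
  interpret prob_space M by fact
  interpret bp: brownian_poisson_space M \<F> B N lam
    by unfold_locales fact+
  define q where "q = 2 * lam * K1 * (2 + K1)"
  define a where "a = \<alpha>1 + \<alpha>2 + q + \<epsilon>"
  define b where "b = \<beta>1 - \<beta>2 - q - \<epsilon>"
  have q: "0 < q" and a: "0 < a" and b: "0 < b"
    using assms by (auto simp: q_def a_def b_def intro!: add_pos_pos mult_pos_pos)
  have bounds: "norm (F1 x) \<le> K1 * (1 + norm x)" "norm (G1 x) \<le> K1 * (1 + norm x)"
    "norm (h x) \<le> K1 * (1 + norm x)" for x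
    using assms(12)[of x] by auto
  have lin: "continuous_on UNIV u"
    if "\<And>x y. norm (u x - u y) \<le> L1 * norm (x - y)" for u :: "real ^ 'd \<Rightarrow> 'z::real_normed_vector"
    using that \<open>L1 > 0\<close> by (intro lipschitz_on_continuous_on[of L1] lipschitz_onI) (auto simp: dist_norm)
  have cont: "continuous_on UNIV F1" "continuous_on UNIV G1" "continuous_on UNIV h"
    using assms(10) by (auto intro!: lin)
  have cont': "continuous_on UNIV F" "continuous_on UNIV G"
    using assms(11) by (auto intro!: continuous_on_poly_lipschitz[OF \<open>L1 > 0\<close> \<open>\<gamma> \<ge> 0\<close>])
  obtain c1 c2 where c: "0 \<le> c2"
    "\<And>x y. (norm (G1 x + G y))\<^sup>2 \<le> c1 * (norm (G1 x))\<^sup>2 + c2 * (norm (G y))\<^sup>2"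
    "\<And>x. 2 * (x \<bullet> F1 x) + c1 * (norm (G1 x))\<^sup>2 \<le> \<alpha>1 - \<beta>1 * (norm x)\<^sup>2"
    "\<And>x. 2 * (x \<bullet> F x) + c2 * (norm (G x))\<^sup>2 \<le> \<alpha>2 + \<beta>2 * (norm x)\<^sup>2"
    using split_dissipative_unified[OF assms(23)] by metis
  define C0 where "C0 = 8 * K1\<^sup>2 + 4 * lam\<^sup>2 * K1\<^sup>2 + 4"
  \<comment> \<open>Radius above 1 activates the growth control; above the square root it makes
    \<alpha>2 / R^2 at most \<epsilon>/2.\<close>
  have "\<forall>\<^sub>F \<Delta> in at_right 0. max 1 (sqrt (2 * \<alpha>2 / \<epsilon>)) < trunc_radius \<mu> \<phi> \<Delta>"
    by (rule eventually_trunc_radius_gt[OF assms(24,25)])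
  \<comment> \<open>Below 1/b the contraction factor 1 - b \<Delta> is nonnegative; the second bound
    gives \<open>C0 * sqrt \<Delta> \<le> \<epsilon> / 2\<close>.\<close>
  moreover have "\<forall>\<^sub>F \<Delta> in at_right 0. \<Delta> \<in> {0<..<min (1 / b) ((\<epsilon> / (2 * C0))\<^sup>2)}"
  proof (rule eventually_at_right_real)
    have "0 < C0" unfolding C0_def by (intro add_nonneg_pos add_nonneg_nonneg) auto
    then show "0 < min (1 / b) ((\<epsilon> / (2 * C0))\<^sup>2)" using b \<open>0 < \<epsilon>\<close> by simp
  qed
  ultimately have "\<forall>\<^sub>F \<Delta> in at_right 0. max 1 (sqrt (2 * \<alpha>2 / \<epsilon>)) < trunc_radius \<mu> \<phi> \<Delta>
      \<and> \<Delta> \<in> {0<..<min (1 / b) ((\<epsilon> / (2 * C0))\<^sup>2)}"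
    by (rule eventually_conj)
  then obtain d where d: "0 < d" and good: "\<And>\<Delta>. 0 < \<Delta> \<Longrightarrow> \<Delta> < d \<Longrightarrow>
      max 1 (sqrt (2 * \<alpha>2 / \<epsilon>)) < trunc_radius \<mu> \<phi> \<Delta> \<and> \<Delta> \<in> {0<..<min (1 / b) ((\<epsilon> / (2 * C0))\<^sup>2)}"
    unfolding eventually_at_right_field by blast
  show ?thesis
  \<comment> \<open>The value 1/2 only keeps the threshold inside (0,1). It is fixed before
    \<open>x0\<close>, hence uniform in the initial value.\<close>
  proof (intro bexI[of _ "min d (1 / 2)"] ballI allI)
    show "min d (1 / 2) \<in> {0<..<1}" using d by auto
    fix \<Delta> and x0 :: "real ^ 'd"
    assume "\<Delta> \<in> {0<..<min d (1 / 2)}"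
    then have \<Delta>: "0 < \<Delta>" "\<Delta> < d" "\<Delta> \<le> 1" by auto
    define R where "R = trunc_radius \<mu> \<phi> \<Delta>"
    have R: "1 < R" "sqrt (2 * \<alpha>2 / \<epsilon>) < R" and \<Delta>b: "\<Delta> < 1 / b" and \<Delta>C: "\<Delta> < (\<epsilon> / (2 * C0))\<^sup>2"
      using good[OF \<Delta>(1,2)] by (auto simp: R_def)
    have R2: "\<alpha>2 / R\<^sup>2 \<le> \<epsilon> / 2"
    proof -
      have "2 * \<alpha>2 / \<epsilon> = (sqrt (2 * \<alpha>2 / \<epsilon>))\<^sup>2" using assms by simp
      also have "\<dots> \<le> R\<^sup>2" using R assms by (intro power_mono) auto
      finally show ?thesis using R \<open>0 < \<epsilon>\<close> by (simp add: field_simps)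
    qed
    have small: "C0 * sqrt \<Delta> \<le> \<epsilon> / 2"
    proof -
      have C0: "0 < C0" unfolding C0_def by (intro add_nonneg_pos add_nonneg_nonneg) auto
      have "sqrt \<Delta> \<le> sqrt ((\<epsilon> / (2 * C0))\<^sup>2)" using \<Delta>C by (intro real_sqrt_le_mono) simp
      also have "\<dots> = \<epsilon> / (2 * C0)" using C0 \<open>0 < \<epsilon>\<close> by simp
      finally show ?thesis using C0 by (simp add: field_simps)
    qed
    let ?f = "part_trunc \<mu> \<phi> \<Delta> F1 F" and ?g = "part_trunc \<mu> \<phi> \<Delta> G1 G"
    have trunc: "norm (F (trunc_map \<mu> \<phi> \<Delta> x)) \<le> \<phi> \<Delta>" "norm (G (trunc_map \<mu> \<phi> \<Delta> x)) \<le> \<phi> \<Delta>" for x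
      using norm_truncated_le[OF assms(24,25) \<Delta>(1,3)] R(1) by (auto simp: R_def)
    have growth: "(norm (?f x))\<^sup>2 \<le> 4 * K1\<^sup>2 * (1 + (norm x)\<^sup>2) + 2 * (\<phi> \<Delta>)\<^sup>2"
      "(norm (?g x))\<^sup>2 \<le> 4 * K1\<^sup>2 * (1 + (norm x)\<^sup>2) + 2 * (\<phi> \<Delta>)\<^sup>2" for x
      using part_trunc_growth[of F1 x K1 F] part_trunc_growth[of G1 x K1 G] bounds trunc by auto
    define C where "C = 4 * K1\<^sup>2 + 2 * (\<phi> \<Delta>)\<^sup>2"
    have C: "4 * K1\<^sup>2 * (1 + (norm x)\<^sup>2) + 2 * (\<phi> \<Delta>)\<^sup>2 \<le> C * (1 + (norm x)\<^sup>2)" for x :: "real ^ 'd"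
      by (simp add: C_def distrib_right distrib_left)
    have hC: "(norm (h x))\<^sup>2 \<le> C * (1 + (norm x)\<^sup>2)" for x
    proof -
      have "2 * K1\<^sup>2 * (1 + (norm x)\<^sup>2) \<le> C * (1 + (norm x)\<^sup>2)"
        by (intro mult_right_mono) (auto simp: C_def add_nonneg_nonneg)
      with linear_growth_sq[OF bounds(3)[of x]] show ?thesis by linarith
    qed
    have diss: "2 * (x \<bullet> ?f x) + (norm (?g x))\<^sup>2 \<le> (\<alpha>1 + \<alpha>2) - ((\<beta>1 - \<beta>2) - \<epsilon> / 2) * (norm x)\<^sup>2" for x
    proof -
      let ?y = "trunc_map \<mu> \<phi> \<Delta> x"
      have "2 * (x \<bullet> F ?y) + c2 * (norm (G ?y))\<^sup>2 \<le> \<alpha>2 + (\<beta>2 + \<alpha>2 / R\<^sup>2) * (norm x)\<^sup>2"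
        using assms(20,21) R by (intro truncated_dissipative[OF c(1) _ _ c(4) R_def]) auto
      also have "\<dots> \<le> \<alpha>2 + (\<beta>2 + \<epsilon> / 2) * (norm x)\<^sup>2"
        using R2 by (intro add_left_mono mult_right_mono) auto
      finally show ?thesis
        using c(2)[of x ?y] c(3)[of x] by (simp add: part_trunc_def inner_add_right algebra_simps)
    qed
    have drift: "(norm (x + \<Delta> *\<^sub>R ?f x))\<^sup>2 + \<Delta> * (norm (?g x))\<^sup>2
        + (lam * \<Delta> + (lam * \<Delta>)\<^sup>2) * (norm (h x))\<^sup>2 + 2 * (lam * \<Delta>) * ((x + \<Delta> *\<^sub>R ?f x) \<bullet> h x)
        \<le> (1 - b * \<Delta>) * (norm x)\<^sup>2 + a * \<Delta>" for x
      using one_step_drift[OF diss growth(1) step_times_truncation_sq_le[OF assms(25) _ \<Delta>(1,3)] bounds(3)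
          \<open>K1 > 0\<close> \<open>lam > 0\<close> \<open>0 < \<epsilon>\<close> \<Delta>(1,3) small[unfolded C0_def], of x] assms(13,16)
      by (simp add: a_def b_def q_def)
    let ?X = "pt_EM F1 F G1 G h \<mu> \<phi> B N \<Delta> x0"
    have XS: "?X (Suc k) = (\<lambda>\<omega>. ?X k \<omega> + \<Delta> *\<^sub>R ?f (?X k \<omega>)
        + ?g (?X k \<omega>) *v (B (real (Suc k) * \<Delta>) \<omega> - B (real k * \<Delta>) \<omega>)
        + (N (real (Suc k) * \<Delta>) \<omega> - N (real k * \<Delta>) \<omega>) *\<^sub>R h (?X k \<omega>))" for k
      by (simp only: pt_EM.simps Let_def)
    have b\<Delta>: "0 < b * \<Delta>" "b * \<Delta> \<le> 1" using b \<Delta>(1) \<Delta>b by (auto simp: field_simps)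
    have pq: "0 \<le> 1 - b * \<Delta>" "0 \<le> a * \<Delta>" using b\<Delta> a \<Delta>(1) by auto
    have hb: "h \<in> borel_measurable borel" using cont(3) by (rule borel_measurable_continuous_onI)
    note EM = bp.euler_maruyama_second_moment[of \<Delta> ?X x0 ?f ?g h, OF \<Delta>(1) pt_EM.simps(1) XS
        borel_measurable_part_trunc[OF cont(1) cont'(1)] borel_measurable_part_trunc[OF cont(2) cont'(2)]
        hb order_trans[OF growth(1) C] order_trans[OF growth(2) C] hC pq drift]
    define e where "e k = expectation (\<lambda>\<omega>. (norm (?X k \<omega>))\<^sup>2)" for k
    have "limsup (\<lambda>k. ennreal (e k)) \<le> ennreal (a / b)"
    \<comment> \<open>Applied with rate \<rho> = b \<Delta> and fixed point c = a / b, so that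
      \<rho> c = a \<Delta>; the step size cancels in the limit.\<close>
    proof (rule limsup_ennreal_affine_recursion[OF _ b\<Delta>])
      fix k
      show "e (Suc k) \<le> (1 - b * \<Delta>) * e k + b * \<Delta> * (a / b)"
        using EM(2)[of k] b by (simp add: e_def mult.commute)
    qed
    moreover have "(\<integral>\<^sup>+ \<omega>. ennreal ((norm (?X k \<omega>))\<^sup>2) \<partial>M) = ennreal (e k)" for k
      using EM(1)[of k] by (simp add: e_def nn_integral_eq_integral)
    ultimately show "limsup (\<lambda>k. \<integral>\<^sup>+ \<omega>. ennreal ((norm (?X k \<omega>))\<^sup>2) \<partial>M)
        \<le> ennreal ((\<alpha>1 + \<alpha>2 + 2 * lam * K1 * (2 + K1) + \<epsilon>)
          / (\<beta>1 - \<beta>2 - 2 * lam * K1 * (2 + K1) - \<epsilon>))"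
      by (simp add: a_def b_def q_def)
  qed
qed

end
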